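(* In the run setting described in the context, let $t,u\in\mathscr C$ and $1\le i\le n$. (1) If $\sigma(T_{i-1})\vdash_{dy}\sigma\mu_i(t)$, then $\sigma^*(T_{i-1})\vdash_{dy}\sigma^*\mu_i^*(t)$. (2) If $\sigma(T_{i-1};E_{i-1})\vdash_{eq}\sigma\mu_i(t\doteq u)$, then $\sigma^*(T_{i-1};E_{i-1})\vdash_{eq}\sigma^*\mu_i^*(t\doteq u)$.
   Context: Terms. Fix disjoint sets $\mathscr N$ of names and $\mathscr V$ of variables; $\mathscr V$ contains a subset $\mathscr V_q$ of quantified variables. Terms: $t::=x\mid m\mid\mathsf f(t_1,\dots,t_n)$ ($x\in\mathscr V$, $m\in\mathscr N$, $\mathsf f$ an $n$-ary operator, including $\mathit{pk}$). $\mathsf{st}$ denotes subterms. Substitutions are finite partial maps from variables to terms; $\lambda\lambda'$ applies $\lambda'$ first. Term derivability $X\vdash_{dy}t$: axiom rule, constructor rules (from $X\vdash t_1,\dots,X\vdash t_n$ infer $X\vdash\mathsf f(t_1,\dots,t_n)$), destructor rules (from $X\vdash\mathsf f(t_1,\dots,t_n)$ and $X\vdash u_1,\dots,X\vdash u_m$ infer $X\vdash t_i$); assumed: normalization, subterm property, polynomial-time decidability. Positions: $\mathrm{pos}(t)$, $t|_p$, $\mathrm{pos}_r(t)$, $t[P\mapsto r]$ as usual; $\mathbb A(S,t)=\{p\in\mathrm{pos}(t):S\vdash_{dy}t|_q\ \forall q\in Q_p\}$ with $Q_p=\{\varepsilon\}\cup\{qi\in\mathrm{pos}(t): q\text{ a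 proper prefix of }p\}$. Assertions: $\alpha::=t\doteq u\mid P(u_1,\dots,u_m)\mid t_0\twoheadleftarrow[t_1,\dots,t_n]\mid\alpha_0\wedge\alpha_1\mid\exists x.\alpha\mid\mathit{pk}(k)\ \mathit{says}\ \alpha$ ($u_i,t_0\in\mathscr N\cup\mathscr V$, $t_j\in\mathscr N$, $x\in\mathscr V_q$); atomic = not a conjunction or existential; $\mathrm{fv},\mathrm{bv}$; $\mathsf{pubs}(\alpha)$ = maximal subterms with no variable of $\mathscr V_q$. Term positions: $\mathrm{pos}(t\doteq t')=0\cdot\mathrm{pos}(t)\cup1\cdot\mathrm{pos}(t')$; $\mathrm{pos}(P(u_0..u_m))=\{0..m\}$; $\mathrm{pos}(t\twoheadleftarrow[t_1..t_n])=\{0..n\}$; $\mathrm{pos}(\alpha\wedge\beta)=0\cdot\mathrm{pos}(\alpha)\cup1\cdot\mathrm{pos}(\beta)$; $\mathrm{pos}(\exists x.\alpha)=0\cdot\mathrm{pos}(\alpha)$; $\mathrm{pos}(\mathit{pk}(k)\ \mathit{says}\ \alpha)=\{0,00\}\cup1\cdot\mathrm{pos}(\alpha)$. Abstractable positions: $\mathbb A(S,t_0\doteq t_1)=\{ip:p\in\mathbb A(S,t_i)\}$; $\mathbb A(S,P(\vec u))=\{i:S\vdash_{dy}u_i\}$; $\mathbb A(S,t\twoheadleftarrow[\dots])=\{0\}$; $\mathbb A(S,\alpha_0\wedge\alpha_1)=\{ip:p\in\mathbb A(S,\alpha_i)\}$; $\mathbb A(S,\exists x.\alpha)=\{0p:p\in\mathbb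 A(S\cup\{x\},\alpha)\}$; $\mathbb A(S,\mathit{pk}(k)\ \mathit{says}\ \alpha)=\{0\}\cup\{1p:p\in\mathbb A(S,\alpha)\}$. Assertion derivability $S;A\vdash_a\alpha$: (ax) $S;A\cup\{\alpha\}\vdash\alpha$; (eq) from $S\vdash_{dy}t$ infer $t\doteq t$; (cons) from $t_j\doteq u_j$ ($j\le r$) infer $\mathsf f(\vec t)\doteq\mathsf f(\vec u)$; (sym); (trans) from $t_1\doteq t_2,\dots,t_k\doteq t_{k+1}$ infer $t_1\doteq t_{k+1}$; (proj$_i$) from $\mathsf f(t_1..t_r)\doteq\mathsf f(u_1..u_r)$ infer $t_i\doteq u_i$ provided the positions of all $t_j,u_j$ are abstractable in that assertion w.r.t. $S$; ($\wedge$I); ($\wedge$E$_i$); (subst) from $t\twoheadleftarrow l$, $t\doteq u$ infer $u\twoheadleftarrow l$; ($\exists$I) from $\alpha[P\mapsto t]$ and $S\vdash_{dy}t$ infer $\exists x.\alpha$, $P=\mathrm{pos}_x(\alpha)\subseteq\mathbb A(S\cup\{x\},\alpha)$; ($\exists$E) from $S;A\vdash\exists x.\alpha$ and $S\cup\{y\};A\cup\{\alpha[P\mapsto y]\}\vdash\gamma$ infer $S;A\vdash\gamma$, $y$ fresh, $P=\mathrm{pos}_x(\alpha)$; (say) from $\alpha$ and $S\vdash_{dy}k$ infer $\mathit{pk}(k)\ \mathit{says}\ \alpha$; (prom) from $t\twoheadleftarrow[n]$ infer $t\doteq n$; (int) from $t\twoheadleftarrow l_1,\dots,t\twoheadleftarrow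 l_m$ infer $t\twoheadleftarrow\bigcap l_j$; (wk) from $t\doteq n_i$ and $S\vdash_{dy}n_j$ for all $j$ infer $t\twoheadleftarrow[n_1..n_k]$. $\vdash_{eq}$: without $\wedge$I, $\wedge$E, $\exists$I, $\exists$E, say. Kernel: $\mathit{ker}(S;A)=(S\cup\mathrm{bv}(A);\bigcup_{\alpha\in A}\mathsf{at}(\alpha))$, $\mathsf{at}(\alpha)$ = maximal atomic subformulas. $\mathsf{hat}$: $\mathsf{hat}(\alpha\wedge\beta)=\mathsf{hat}(\alpha)\cup\mathsf{hat}(\beta)$, $\mathsf{hat}(\exists x.\alpha)=\mathsf{hat}(\alpha)$, $\mathsf{hat}(\mathit{pk}(k)\ \mathit{says}\ \alpha)=\{\mathit{pk}(k)\ \mathit{says}\ \alpha\}\cup\mathsf{hat}(\alpha)$, otherwise $\{\gamma\}$. Protocols and runs. Agents $\mathscr A\subseteq\mathscr N$ include the intruder $I$. A protocol is a finite set of roles $(\beta_1,\alpha_1)\cdots(\beta_m,\alpha_m)$; agent variables are free variables first occurring in some $\alpha_j$. A session is $u:(\beta_1\Rightarrow\alpha_1)\cdots u:(\beta_\ell\Rightarrow\alpha_\ell)$, $u\in\mathscr A$, a role prefix with agent variables instantiated by names; coherent sets of sessions share no free variables. $\mathit{update}((X;\Phi),\alpha)=(X\cup\mathsf{pubs}(\alpha);\Phi\cup\{\alpha\})$. Run setting: fix a run $(\xi,\sigma)$: $\xi=u_1:(\beta_1\Rightarrow\alpha_1),\dots,u_n:(\beta_n\Rightarrow\alpha_n)$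 an interleaving of a finite coherent set of sessions, $\sigma$ a ground substitution with domain the free variables of $\xi$, with knowledge functions $\mathsf k_0,\dots,\mathsf k_n$: $\mathsf k_0(a)=(X_a;\emptyset)$, and for $1\le i\le n$, $\mathsf k_i(a)=\mathsf k_{i-1}(a)$ for $a\notin\{u_i,I\}$, $\mathsf k_i(u_i)=\mathit{update}(\mathsf k_{i-1}(u_i),\beta_i)$, $\mathsf k_i(I)=\mathit{update}(\mathsf k_{i-1}(I),\alpha_i)$, with $\mathsf k_i(u_i)\vdash_a\alpha_i$ and $\sigma(\mathsf k_{i-1}(I))\vdash_a\sigma(\beta_i)$. Variables are renamed so that the free variables of $\xi$ are not in $\mathscr V_q$, no variable occurs both free and bound, and none is bound twice. $(T_i;E_i)=\mathit{ker}(\mathsf k_i(I))$, $(U_i;F_i)=\mathit{ker}(\mathsf k_i(u_i))$. For each $1\le i\le n$ fix $X_i\subseteq\mathsf{hat}(\beta_i)$ and $\mu_i$ with domain $\mathrm{bv}(\beta_i)\setminus\mathrm{bv}(X_i)$ such that $\sigma(T_{i-1})\vdash_{dy}\mu_i(x)$ for $x\in\mathrm{dom}(\mu_i)$ and $\sigma(T_{i-1};E_{i-1})\vdash_{eq}\sigma\mu_i(\gamma)$ for $\gamma\in X_i$; and $Y_i\subseteq\mathsf{hat}(\alpha_i)$, $\theta_i$ with domain $\mathrm{bv}(\alpha_i)\setminus\mathrm{bv}(Y_i)$ such that $\sigma(U_i)\vdash_{dy}\theta_i(x)$ and $\sigma(U_i;F_i)\vdash_{eq}\sigma\theta_i(\gamma)$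 for $\gamma\in Y_i$. $\omega=\sigma\mu_1\theta_1\cdots\mu_n\theta_n$. $\mathscr C=\bigcup_{i\le n}(\mathsf{st}(T_i\cup U_i)\cup\mathsf{st}(E_i\cup F_i))$, $\mathscr D=\mathscr C\setminus\mathscr V$. Zapping. Standing assumption: there is a name $\mathsf m\in T_0\cap\mathscr N$ with $\mathsf m\notin\mathsf{st}(\{\alpha_i,\beta_i\})\cup\mathsf{st}(\mathrm{rng}(\theta_i)\cup\mathrm{rng}(\mu_i))$ for all $i$. A term $t$ is zappable if there is $x\in\mathrm{dom}(\omega)$ with $\omega(t)=\omega(x)$ but no $u\in\mathscr D$ with $\omega(x)=\omega(u)$. $\mathrm{zap}(x)=x$ for variables; $\mathrm{zap}(n)=\mathsf m$ if the name $n$ is zappable, else $n$; $\mathrm{zap}(\mathsf f(t_1,\dots,t_k))=\mathsf m$ if zappable, else $\mathsf f(\mathrm{zap}(t_1),\dots,\mathrm{zap}(t_k))$. For $\lambda\in\{\sigma,\omega,\mu_i\}$, $\lambda^*(x)=\mathrm{zap}(\lambda(x))$ for all $x\in\mathscr V$.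
   Formalization: Added: X_i and Y_i must cover β_i and α_i (each is built from them by ∧, ∃, says), else the claim fails; initial knowledge X_a is ground; destructor rules take f(t_1..t_n) with arbitrary t_j, so patterns like aenc(t,pk(k)), for which it fails, are excluded. *)

theory Defs
  imports Main
begin

section \<open>Terms, positions and substitutions\<close>

text \<open>A symbol together with the length of its argument list is an operator of that arity.\<close>

datatype ('f, 'n, vars: 'v) trm =
    Var 'v
  | Nm 'n
  | Fn 'f "('f, 'n, 'v) trm list"

fun st :: "('f, 'n, 'v) trm \<Rightarrow> ('f, 'n, 'v) trm set" where
  "st (Var x) = {Var x}"
| "st (Nm a) = {Nm a}"
| "st (Fn f ts) = insert (Fn f ts) (\<Union>t\<in>set ts. st t)"

fun is_pos :: "('f, 'n, 'v) trm \<Rightarrow> nat list \<Rightarrow> bool" where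
  "is_pos t [] \<longleftrightarrow> True"
| "is_pos (Fn f ts) (i # p) \<longleftrightarrow> i < length ts \<and> is_pos (ts ! i) p"
| "is_pos _ (i # p) \<longleftrightarrow> False"

definition pos :: "('f, 'n, 'v) trm \<Rightarrow> nat list set" where
  "pos t = {p. is_pos t p}"

text \<open>Meaningful for positions of the term only.\<close>

fun sub_at :: "('f, 'n, 'v) trm \<Rightarrow> nat list \<Rightarrow> ('f, 'n, 'v) trm" where
  "sub_at t [] = t"
| "sub_at (Fn f ts) (i # p) = sub_at (ts ! i) p"
| "sub_at t (i # p) = t"

function repl :: "('f, 'n, 'v) trm \<Rightarrow> nat list set \<Rightarrow> ('f, 'n, 'v) trm \<Rightarrow> ('f, 'n, 'v) trm" where
  "repl (Var x) P r = (if [] \<in> P then r else Var x)"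
| "repl (Nm a) P r = (if [] \<in> P then r else Nm a)"
| "repl (Fn f ts) P r =
     (if [] \<in> P then r
      else Fn f (map (\<lambda>i. repl (ts ! i) {p. i # p \<in> P} r) [0..<length ts]))"
  by pat_completeness auto
termination
  by (relation "measure (\<lambda>(t, P, r). size t)") (auto simp: less_Suc_eq_le intro: size_list_estimation'[OF nth_mem])

type_synonym ('f, 'n, 'v) subst = "'v \<rightharpoonup> ('f, 'n, 'v) trm"

fun tsubst :: "('f, 'n, 'v) subst \<Rightarrow> ('f, 'n, 'v) trm \<Rightarrow> ('f, 'n, 'v) trm" where
  "tsubst l (Var x) = (case l x of None \<Rightarrow> Var x | Some t \<Rightarrow> t)"
| "tsubst l (Nm a) = Nm a"
| "tsubst l (Fn f ts) = Fn f (map (tsubst l) ts)"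

text \<open>In \<open>scomp l l'\<close> the substitution \<open>l'\<close> is applied first.\<close>

definition scomp :: "('f, 'n, 'v) subst \<Rightarrow> ('f, 'n, 'v) subst \<Rightarrow> ('f, 'n, 'v) subst" where
  "scomp l l' = (\<lambda>x. if x \<in> dom l \<union> dom l' then Some (tsubst l (tsubst l' (Var x))) else None)"

section \<open>Term derivability\<close>

text \<open>
  Every operator has its constructor rule. A destructor rule \<open>(f, n, us, i)\<close> is a schema over
  metavariables: from \<open>f(t\<^sub>0, \<dots>, t\<^sub>n\<^sub>-\<^sub>1)\<close>, for arbitrary terms \<open>t\<^sub>j\<close>, and the instances of the
  patterns in \<open>us\<close>, infer \<open>t\<^sub>i\<close>. \<open>Meta j\<close> with \<open>j < n\<close> stands for \<open>t\<^sub>j\<close>; further metavariables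
  are arbitrary terms.
\<close>

datatype 'f pat = Meta nat | PFn 'f "'f pat list"

type_synonym 'f drule = "'f \<times> nat \<times> 'f pat list \<times> nat"

fun pinst :: "(nat \<Rightarrow> ('f, 'n, 'v) trm) \<Rightarrow> 'f pat \<Rightarrow> ('f, 'n, 'v) trm" where
  "pinst \<rho> (Meta j) = \<rho> j"
| "pinst \<rho> (PFn f us) = Fn f (map (pinst \<rho>) us)"

text \<open>In \<open>DDes\<close> the first subproof derives the major premise, the list the remaining ones.\<close>

datatype ('f, 'n, 'v) dproof =
    DAx "('f, 'n, 'v) trm"
  | DCon 'f "('f, 'n, 'v) dproof list"
  | DDes "'f drule" "nat \<Rightarrow> ('f, 'n, 'v) trm" "('f, 'n, 'v) dproof" "('f, 'n, 'v) dproof list"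

fun concl :: "('f, 'n, 'v) dproof \<Rightarrow> ('f, 'n, 'v) trm" where
  "concl (DAx t) = t"
| "concl (DCon f ps) = Fn f (map concl ps)"
| "concl (DDes (f, n, us, i) \<rho> p ps) = \<rho> i"

fun valid_proof ::
  "'f drule set \<Rightarrow> ('f, 'n, 'v) trm set \<Rightarrow> ('f, 'n, 'v) dproof \<Rightarrow> bool" where
  "valid_proof R X (DAx t) \<longleftrightarrow> t \<in> X"
| "valid_proof R X (DCon f ps) \<longleftrightarrow> (\<forall>p\<in>set ps. valid_proof R X p)"
| "valid_proof R X (DDes (f, n, us, i) \<rho> p ps) \<longleftrightarrow>
     (f, n, us, i) \<in> R \<and> i < n \<and>
     concl p = Fn f (map \<rho> [0..<n]) \<and> map concl ps = map (pinst \<rho>) us \<and>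
     valid_proof R X p \<and> (\<forall>q\<in>set ps. valid_proof R X q)"

definition dy ::
  "'f drule set \<Rightarrow> ('f, 'n, 'v) trm set \<Rightarrow> ('f, 'n, 'v) trm \<Rightarrow> bool" where
  "dy R X t \<longleftrightarrow> (\<exists>p. valid_proof R X p \<and> concl p = t)"

fun proof_terms :: "('f, 'n, 'v) dproof \<Rightarrow> ('f, 'n, 'v) trm set" where
  "proof_terms (DAx t) = {t}"
| "proof_terms (DCon f ps) = insert (concl (DCon f ps)) (\<Union>p\<in>set ps. proof_terms p)"
| "proof_terms (DDes d \<rho> p ps) =
     insert (concl (DDes d \<rho> p ps)) (proof_terms p \<union> (\<Union>q\<in>set ps. proof_terms q))"

fun ends_in_con :: "('f, 'n, 'v) dproof \<Rightarrow> bool" where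
  "ends_in_con (DCon f ps) \<longleftrightarrow> True"
| "ends_in_con _ \<longleftrightarrow> False"

fun normal_proof :: "('f, 'n, 'v) dproof \<Rightarrow> bool" where
  "normal_proof (DAx t) \<longleftrightarrow> True"
| "normal_proof (DCon f ps) \<longleftrightarrow> (\<forall>p\<in>set ps. normal_proof p)"
| "normal_proof (DDes d \<rho> p ps) \<longleftrightarrow>
     \<not> ends_in_con p \<and> normal_proof p \<and> (\<forall>q\<in>set ps. normal_proof q)"

definition normalization :: "('f, 'n, 'v) trm itself \<Rightarrow> 'f drule set \<Rightarrow> bool" where
  "normalization ty R \<longleftrightarrow>
     (\<forall>X (t :: ('f, 'n, 'v) trm). dy R X t \<longrightarrow>
        (\<exists>p. valid_proof R X p \<and> normal_proof p \<and> concl p = t))"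

definition subterm_property :: "('f, 'n, 'v) trm itself \<Rightarrow> 'f drule set \<Rightarrow> bool" where
  "subterm_property ty R \<longleftrightarrow>
     (\<forall>X (p :: ('f, 'n, 'v) dproof). valid_proof R X p \<and> normal_proof p \<longrightarrow>
        proof_terms p \<subseteq> \<Union> (st ` insert (concl p) X) \<and>
        (\<not> ends_in_con p \<longrightarrow> proof_terms p \<subseteq> \<Union> (st ` X)))"

definition tabs ::
  "'f drule set \<Rightarrow> ('f, 'n, 'v) trm set \<Rightarrow> ('f, 'n, 'v) trm \<Rightarrow> nat list set" where
  "tabs R S t =
     {p \<in> pos t. \<forall>q \<in> {[]} \<union> {q @ [i] | q i. q @ [i] \<in> pos t \<and> (\<exists>p'. p' \<noteq> [] \<and> p = q @ p')}.
        dy R S (sub_at t q)}"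

section \<open>Assertions\<close>

text \<open>
  The datatype is closed under substitution; the grammar, in which predicate arguments, the
  subject of a list assertion and the key of a says-assertion are names or variables and
  quantified variables belong to \<open>Vq\<close>, is \<open>wf_assn\<close>. \<open>Says k \<alpha>\<close> is \<open>pk(k) says \<alpha>\<close>, and
  \<open>InList t ns\<close> states that \<open>t\<close> is one of the names in \<open>ns\<close>.
\<close>

datatype ('f, 'n, 'v, 'p) assn =
    Eq "('f, 'n, 'v) trm" "('f, 'n, 'v) trm"
  | Pred 'p "('f, 'n, 'v) trm list"
  | InList "('f, 'n, 'v) trm" "'n list"
  | And "('f, 'n, 'v, 'p) assn" "('f, 'n, 'v, 'p) assn"
  | Ex 'v "('f, 'n, 'v, 'p) assn"
  | Says "('f, 'n, 'v) trm" "('f, 'n, 'v, 'p) assn"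

definition name_or_var :: "('f, 'n, 'v) trm \<Rightarrow> bool" where
  "name_or_var t \<longleftrightarrow> (\<exists>x. t = Var x) \<or> (\<exists>a. t = Nm a)"

fun wf_assn :: "'v set \<Rightarrow> ('f, 'n, 'v, 'p) assn \<Rightarrow> bool" where
  "wf_assn Vq (Eq t u) \<longleftrightarrow> True"
| "wf_assn Vq (Pred P us) \<longleftrightarrow> (\<forall>u\<in>set us. name_or_var u)"
| "wf_assn Vq (InList t ns) \<longleftrightarrow> name_or_var t"
| "wf_assn Vq (And \<alpha> \<beta>) \<longleftrightarrow> wf_assn Vq \<alpha> \<and> wf_assn Vq \<beta>"
| "wf_assn Vq (Ex x \<alpha>) \<longleftrightarrow> x \<in> Vq \<and> wf_assn Vq \<alpha>"
| "wf_assn Vq (Says k \<alpha>) \<longleftrightarrow> name_or_var k \<and> wf_assn Vq \<alpha>"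

fun fv :: "('f, 'n, 'v, 'p) assn \<Rightarrow> 'v set" where
  "fv (Eq t u) = vars t \<union> vars u"
| "fv (Pred P us) = (\<Union>u\<in>set us. vars u)"
| "fv (InList t ns) = vars t"
| "fv (And \<alpha> \<beta>) = fv \<alpha> \<union> fv \<beta>"
| "fv (Ex x \<alpha>) = fv \<alpha> - {x}"
| "fv (Says k \<alpha>) = vars k \<union> fv \<alpha>"

text \<open>The bound variables, listed once per binder.\<close>

fun bvs :: "('f, 'n, 'v, 'p) assn \<Rightarrow> 'v list" where
  "bvs (And \<alpha> \<beta>) = bvs \<alpha> @ bvs \<beta>"
| "bvs (Ex x \<alpha>) = x # bvs \<alpha>"
| "bvs (Says k \<alpha>) = bvs \<alpha>"
| "bvs _ = []"

definition bv :: "('f, 'n, 'v, 'p) assn \<Rightarrow> 'v set" where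
  "bv \<alpha> = set (bvs \<alpha>)"

fun aterms :: "'f \<Rightarrow> ('f, 'n, 'v, 'p) assn \<Rightarrow> ('f, 'n, 'v) trm set" where
  "aterms pk (Eq t u) = {t, u}"
| "aterms pk (Pred P us) = set us"
| "aterms pk (InList t ns) = insert t (Nm ` set ns)"
| "aterms pk (And \<alpha> \<beta>) = aterms pk \<alpha> \<union> aterms pk \<beta>"
| "aterms pk (Ex x \<alpha>) = aterms pk \<alpha>"
| "aterms pk (Says k \<alpha>) = insert (Fn pk [k]) (aterms pk \<alpha>)"

definition ast :: "'f \<Rightarrow> ('f, 'n, 'v, 'p) assn \<Rightarrow> ('f, 'n, 'v) trm set" where
  "ast pk \<alpha> = \<Union> (st ` aterms pk \<alpha>)"

text \<open>Maximality is taken per occurrence: \<open>h(a) \<doteq> a\<close> has the two public subterms \<open>h(a)\<close>, \<open>a\<close>.\<close>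

fun tpubs :: "'v set \<Rightarrow> ('f, 'n, 'v) trm \<Rightarrow> ('f, 'n, 'v) trm set" where
  "tpubs Vq (Var x) = (if x \<in> Vq then {} else {Var x})"
| "tpubs Vq (Nm a) = {Nm a}"
| "tpubs Vq (Fn f ts) =
     (if vars (Fn f ts) \<inter> Vq = {} then {Fn f ts} else (\<Union>t\<in>set ts. tpubs Vq t))"

definition pubs :: "'v set \<Rightarrow> 'f \<Rightarrow> ('f, 'n, 'v, 'p) assn \<Rightarrow> ('f, 'n, 'v) trm set" where
  "pubs Vq pk \<alpha> = \<Union> (tpubs Vq ` aterms pk \<alpha>)"

text \<open>Application to free occurrences; bound variables are never renamed.\<close>

fun asubst :: "('f, 'n, 'v) subst \<Rightarrow> ('f, 'n, 'v, 'p) assn \<Rightarrow> ('f, 'n, 'v, 'p) assn" where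
  "asubst l (Eq t u) = Eq (tsubst l t) (tsubst l u)"
| "asubst l (Pred P us) = Pred P (map (tsubst l) us)"
| "asubst l (InList t ns) = InList (tsubst l t) ns"
| "asubst l (And \<alpha> \<beta>) = And (asubst l \<alpha>) (asubst l \<beta>)"
| "asubst l (Ex x \<alpha>) = Ex x (asubst (l(x := None)) \<alpha>)"
| "asubst l (Says k \<alpha>) = Says (tsubst l k) (asubst l \<alpha>)"

text \<open>
  Equality up to renaming of bound variables; the list pairs the binders passed so far,
  innermost first.
\<close>

fun var_eq :: "('v \<times> 'v) list \<Rightarrow> 'v \<Rightarrow> 'v \<Rightarrow> bool" where
  "var_eq [] x y \<longleftrightarrow> x = y"
| "var_eq ((a, b) # e) x y \<longleftrightarrow> (if x = a \<or> y = b then x = a \<and> y = b else var_eq e x y)"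

fun trm_eq :: "('v \<times> 'v) list \<Rightarrow> ('f, 'n, 'v) trm \<Rightarrow> ('f, 'n, 'v) trm \<Rightarrow> bool" where
  "trm_eq e (Var x) (Var y) \<longleftrightarrow> var_eq e x y"
| "trm_eq e (Nm a) (Nm b) \<longleftrightarrow> a = b"
| "trm_eq e (Fn f ts) (Fn g us) \<longleftrightarrow> f = g \<and> list_all2 (trm_eq e) ts us"
| "trm_eq e _ _ \<longleftrightarrow> False"

fun alpha_env ::
  "('v \<times> 'v) list \<Rightarrow> ('f, 'n, 'v, 'p) assn \<Rightarrow> ('f, 'n, 'v, 'p) assn \<Rightarrow> bool" where
  "alpha_env e (Eq t u) (Eq t' u') \<longleftrightarrow> trm_eq e t t' \<and> trm_eq e u u'"
| "alpha_env e (Pred P us) (Pred Q vs) \<longleftrightarrow> P = Q \<and> list_all2 (trm_eq e) us vs"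
| "alpha_env e (InList t ns) (InList u ms) \<longleftrightarrow> trm_eq e t u \<and> ns = ms"
| "alpha_env e (And \<alpha> \<beta>) (And \<alpha>' \<beta>') \<longleftrightarrow> alpha_env e \<alpha> \<alpha>' \<and> alpha_env e \<beta> \<beta>'"
| "alpha_env e (Ex x \<alpha>) (Ex y \<beta>) \<longleftrightarrow> alpha_env ((x, y) # e) \<alpha> \<beta>"
| "alpha_env e (Says k \<alpha>) (Says l \<beta>) \<longleftrightarrow> trm_eq e k l \<and> alpha_env e \<alpha> \<beta>"
| "alpha_env e _ _ \<longleftrightarrow> False"

definition alpha_eq :: "('f, 'n, 'v, 'p) assn \<Rightarrow> ('f, 'n, 'v, 'p) assn \<Rightarrow> bool" where
  "alpha_eq = alpha_env []"

fun apos :: "('f, 'n, 'v, 'p) assn \<Rightarrow> nat list set" where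
  "apos (Eq t u) = (#) 0 ` pos t \<union> (#) 1 ` pos u"
| "apos (Pred P us) = {[i] | i. i < length us}"
| "apos (InList t ns) = {[i] | i. i \<le> length ns}"
| "apos (And \<alpha> \<beta>) = (#) 0 ` apos \<alpha> \<union> (#) 1 ` apos \<beta>"
| "apos (Ex x \<alpha>) = (#) 0 ` apos \<alpha>"
| "apos (Says k \<alpha>) = {[0], [0, 0]} \<union> (#) 1 ` apos \<alpha>"

text \<open>Meaningful for \<open>p \<in> apos \<alpha>\<close> only.\<close>

fun asub_at :: "'f \<Rightarrow> ('f, 'n, 'v, 'p) assn \<Rightarrow> nat list \<Rightarrow> ('f, 'n, 'v) trm" where
  "asub_at pk (Eq t u) p = (if hd p = 0 then sub_at t (tl p) else sub_at u (tl p))"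
| "asub_at pk (Pred P us) p = us ! hd p"
| "asub_at pk (InList t ns) p = (if hd p = 0 then t else Nm (ns ! (hd p - 1)))"
| "asub_at pk (And \<alpha> \<beta>) p = (if hd p = 0 then asub_at pk \<alpha> (tl p) else asub_at pk \<beta> (tl p))"
| "asub_at pk (Ex x \<alpha>) p = asub_at pk \<alpha> (tl p)"
| "asub_at pk (Says k \<alpha>) p =
     (if p = [0] then Fn pk [k] else if p = [0, 0] then k else asub_at pk \<alpha> (tl p))"

definition apos_of :: "'f \<Rightarrow> 'v \<Rightarrow> ('f, 'n, 'v, 'p) assn \<Rightarrow> nat list set" where
  "apos_of pk x \<alpha> = {p \<in> apos \<alpha>. asub_at pk \<alpha> p = Var x}"

text \<open>
  Only used for sets \<open>P\<close> of positions of variables, which contain neither the positions of the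
  names in a list nor the position \<open>0\<close> of \<open>pk(k)\<close>.
\<close>

fun arepl ::
  "('f, 'n, 'v, 'p) assn \<Rightarrow> nat list set \<Rightarrow> ('f, 'n, 'v) trm \<Rightarrow> ('f, 'n, 'v, 'p) assn" where
  "arepl (Eq t u) P r = Eq (repl t {p. 0 # p \<in> P} r) (repl u {p. 1 # p \<in> P} r)"
| "arepl (Pred Q us) P r = Pred Q (map (\<lambda>i. if [i] \<in> P then r else us ! i) [0..<length us])"
| "arepl (InList t ns) P r = InList (if [0] \<in> P then r else t) ns"
| "arepl (And \<alpha> \<beta>) P r = And (arepl \<alpha> {p. 0 # p \<in> P} r) (arepl \<beta> {p. 1 # p \<in> P} r)"
| "arepl (Ex x \<alpha>) P r = Ex x (arepl \<alpha> {p. 0 # p \<in> P} r)"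
| "arepl (Says k \<alpha>) P r = Says (if [0, 0] \<in> P then r else k) (arepl \<alpha> {p. 1 # p \<in> P} r)"

fun aabs ::
  "'f drule set \<Rightarrow> ('f, 'n, 'v) trm set \<Rightarrow> ('f, 'n, 'v, 'p) assn \<Rightarrow> nat list set" where
  "aabs R S (Eq t u) = (#) 0 ` tabs R S t \<union> (#) 1 ` tabs R S u"
| "aabs R S (Pred P us) = {[i] | i. i < length us \<and> dy R S (us ! i)}"
| "aabs R S (InList t ns) = {[0]}"
| "aabs R S (And \<alpha> \<beta>) = (#) 0 ` aabs R S \<alpha> \<union> (#) 1 ` aabs R S \<beta>"
| "aabs R S (Ex x \<alpha>) = (#) 0 ` aabs R (insert (Var x) S) \<alpha>"
| "aabs R S (Says k \<alpha>) = {[0]} \<union> (#) 1 ` aabs R S \<alpha>"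

section \<open>Assertion derivability\<close>

text \<open>
  The flag \<open>full\<close> enables the rules for conjunction, the existential quantifier and says.
  As assertions are identified up to renaming of bound variables, so are the axioms.
\<close>

inductive ded ::
  "'v set \<Rightarrow> 'f \<Rightarrow> 'f drule set \<Rightarrow> bool \<Rightarrow>
   ('f, 'n, 'v) trm set \<Rightarrow> ('f, 'n, 'v, 'p) assn set \<Rightarrow> ('f, 'n, 'v, 'p) assn \<Rightarrow> bool"
  for Vq pk R full where
  ax: "\<alpha> \<in> A \<Longrightarrow> alpha_eq \<alpha> \<beta> \<Longrightarrow> ded Vq pk R full S A \<beta>"
| eq: "dy R S t \<Longrightarrow> ded Vq pk R full S A (Eq t t)"
| cons: "list_all2 (\<lambda>t u. ded Vq pk R full S A (Eq t u)) ts us \<Longrightarrow>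
    ded Vq pk R full S A (Eq (Fn f ts) (Fn f us))"
| sym: "ded Vq pk R full S A (Eq t u) \<Longrightarrow> ded Vq pk R full S A (Eq u t)"
| trans: "2 \<le> length ts \<Longrightarrow>
    \<forall>j. Suc j < length ts \<longrightarrow> ded Vq pk R full S A (Eq (ts ! j) (ts ! Suc j)) \<Longrightarrow>
    ded Vq pk R full S A (Eq (hd ts) (last ts))"
| proj: "ded Vq pk R full S A (Eq (Fn f ts) (Fn f us)) \<Longrightarrow>
    length ts = length us \<Longrightarrow> i < length ts \<Longrightarrow>
    \<forall>j<length ts. {[0, j], [1, j]} \<subseteq>
      aabs R S (Eq (Fn f ts) (Fn f us) :: ('f, 'n, 'v, 'p) assn) \<Longrightarrow>
    ded Vq pk R full S A (Eq (ts ! i) (us ! i))"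
| subst: "ded Vq pk R full S A (InList t ns) \<Longrightarrow> ded Vq pk R full S A (Eq t u) \<Longrightarrow>
    ded Vq pk R full S A (InList u ns)"
| prom: "ded Vq pk R full S A (InList t [a]) \<Longrightarrow> ded Vq pk R full S A (Eq t (Nm a))"
| int: "ls \<noteq> [] \<Longrightarrow> \<forall>l\<in>set ls. ded Vq pk R full S A (InList t l) \<Longrightarrow>
    set ns = \<Inter> (set ` set ls) \<Longrightarrow> ded Vq pk R full S A (InList t ns)"
| wk: "ded Vq pk R full S A (Eq t (Nm a)) \<Longrightarrow> a \<in> set ns \<Longrightarrow>
    \<forall>b\<in>set ns. dy R S (Nm b) \<Longrightarrow> ded Vq pk R full S A (InList t ns)"
| andI: "full \<Longrightarrow> ded Vq pk R full S A \<alpha> \<Longrightarrow> ded Vq pk R full S A \<beta> \<Longrightarrow>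
    ded Vq pk R full S A (And \<alpha> \<beta>)"
| andE1: "full \<Longrightarrow> ded Vq pk R full S A (And \<alpha> \<beta>) \<Longrightarrow> ded Vq pk R full S A \<alpha>"
| andE2: "full \<Longrightarrow> ded Vq pk R full S A (And \<alpha> \<beta>) \<Longrightarrow> ded Vq pk R full S A \<beta>"
| exI: "full \<Longrightarrow> x \<in> Vq \<Longrightarrow> P = apos_of pk x \<alpha> \<Longrightarrow> P \<subseteq> aabs R (insert (Var x) S) \<alpha> \<Longrightarrow>
    ded Vq pk R full S A (arepl \<alpha> P t) \<Longrightarrow> dy R S t \<Longrightarrow>
    ded Vq pk R full S A (Ex x \<alpha>)"
| exE: "full \<Longrightarrow> ded Vq pk R full S A (Ex x \<alpha>) \<Longrightarrow> P = apos_of pk x \<alpha> \<Longrightarrow> y \<in> Vq \<Longrightarrow>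
    y \<notin> (\<Union>s\<in>S. vars s) \<union> (\<Union>\<delta>\<in>insert (Ex x \<alpha>) (insert \<gamma> A). fv \<delta> \<union> bv \<delta>) \<Longrightarrow>
    ded Vq pk R full (insert (Var y) S) (insert (arepl \<alpha> P (Var y)) A) \<gamma> \<Longrightarrow>
    ded Vq pk R full S A \<gamma>"
| say: "full \<Longrightarrow> ded Vq pk R full S A \<alpha> \<Longrightarrow> dy R S k \<Longrightarrow> ded Vq pk R full S A (Says k \<alpha>)"

type_synonym ('f, 'n, 'v, 'p) knowledge = "('f, 'n, 'v) trm set \<times> ('f, 'n, 'v, 'p) assn set"

definition ded_a ::
  "'v set \<Rightarrow> 'f \<Rightarrow> 'f drule set \<Rightarrow> ('f, 'n, 'v, 'p) knowledge \<Rightarrow> ('f, 'n, 'v, 'p) assn \<Rightarrow> bool" where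
  "ded_a Vq pk R K \<alpha> \<longleftrightarrow> ded Vq pk R True (fst K) (snd K) \<alpha>"

definition ded_eq ::
  "'v set \<Rightarrow> 'f \<Rightarrow> 'f drule set \<Rightarrow> ('f, 'n, 'v, 'p) knowledge \<Rightarrow> ('f, 'n, 'v, 'p) assn \<Rightarrow> bool" where
  "ded_eq Vq pk R K \<alpha> \<longleftrightarrow> ded Vq pk R False (fst K) (snd K) \<alpha>"

definition ksubst ::
  "('f, 'n, 'v) subst \<Rightarrow> ('f, 'n, 'v, 'p) knowledge \<Rightarrow> ('f, 'n, 'v, 'p) knowledge" where
  "ksubst l K = (tsubst l ` fst K, asubst l ` snd K)"

fun at :: "('f, 'n, 'v, 'p) assn \<Rightarrow> ('f, 'n, 'v, 'p) assn set" where
  "at (And \<alpha> \<beta>) = at \<alpha> \<union> at \<beta>"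
| "at (Ex x \<alpha>) = at \<alpha>"
| "at \<gamma> = {\<gamma>}"

fun hat :: "('f, 'n, 'v, 'p) assn \<Rightarrow> ('f, 'n, 'v, 'p) assn set" where
  "hat (And \<alpha> \<beta>) = hat \<alpha> \<union> hat \<beta>"
| "hat (Ex x \<alpha>) = hat \<alpha>"
| "hat (Says k \<alpha>) = insert (Says k \<alpha>) (hat \<alpha>)"
| "hat \<gamma> = {\<gamma>}"

definition ker :: "('f, 'n, 'v, 'p) knowledge \<Rightarrow> ('f, 'n, 'v, 'p) knowledge" where
  "ker K = (fst K \<union> Var ` (\<Union>\<alpha>\<in>snd K. bv \<alpha>), \<Union> (at ` snd K))"

text \<open>
  \<open>covers X \<alpha>\<close>: the assertion \<open>\<alpha>\<close> can be assembled from members of \<open>X\<close> by introducing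
  conjunctions, quantifiers and says, so that \<open>X\<close> can be the set of leaves of a derivation
  of \<open>\<alpha>\<close>.
\<close>

fun covers :: "('f, 'n, 'v, 'p) assn set \<Rightarrow> ('f, 'n, 'v, 'p) assn \<Rightarrow> bool" where
  "covers X (And \<alpha> \<beta>) \<longleftrightarrow> covers X \<alpha> \<and> covers X \<beta>"
| "covers X (Ex x \<alpha>) \<longleftrightarrow> covers X \<alpha>"
| "covers X (Says k \<alpha>) \<longleftrightarrow> Says k \<alpha> \<in> X \<or> covers X \<alpha>"
| "covers X \<gamma> \<longleftrightarrow> \<gamma> \<in> X"

section \<open>Protocols and runs\<close>

text \<open>A pair \<open>(\<beta>, \<alpha>)\<close> consists of a received assertion \<open>\<beta>\<close> and a sent assertion \<open>\<alpha>\<close>.\<close>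

type_synonym ('f, 'n, 'v, 'p) role = "(('f, 'n, 'v, 'p) assn \<times> ('f, 'n, 'v, 'p) assn) list"
type_synonym ('f, 'n, 'v, 'p) event = "'n \<times> ('f, 'n, 'v, 'p) assn \<times> ('f, 'n, 'v, 'p) assn"

definition is_protocol :: "'v set \<Rightarrow> ('f, 'n, 'v, 'p) role set \<Rightarrow> bool" where
  "is_protocol Vq Pr \<longleftrightarrow>
     finite Pr \<and> (\<forall>\<eta>\<in>Pr. \<forall>(\<beta>, \<alpha>)\<in>set \<eta>. wf_assn Vq \<beta> \<and> wf_assn Vq \<alpha>)"

definition agent_vars :: "('f, 'n, 'v, 'p) role \<Rightarrow> 'v set" where
  "agent_vars \<eta> =
     {x. \<exists>j<length \<eta>. x \<in> fv (snd (\<eta> ! j)) \<and> (\<forall>l\<le>j. x \<notin> fv (fst (\<eta> ! l)))}"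

definition is_session ::
  "'n set \<Rightarrow> ('f, 'n, 'v, 'p) role set \<Rightarrow> ('f, 'n, 'v, 'p) event list \<Rightarrow> bool" where
  "is_session Ag Pr s \<longleftrightarrow>
     (\<exists>a\<in>Ag. \<exists>\<eta>\<in>Pr. \<exists>len\<le>length \<eta>. \<exists>\<rho>.
        let inst = (\<lambda>x. if x \<in> agent_vars \<eta> then Some (Nm (\<rho> x)) else None)
        in s = map (\<lambda>(\<beta>, \<alpha>). (a, asubst inst \<beta>, asubst inst \<alpha>)) (take len \<eta>))"

definition fv_events :: "('f, 'n, 'v, 'p) event list \<Rightarrow> 'v set" where
  "fv_events es = (\<Union>(a, \<beta>, \<alpha>)\<in>set es. fv \<beta> \<union> fv \<alpha>)"

definition bvs_events :: "('f, 'n, 'v, 'p) event list \<Rightarrow> 'v list" where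
  "bvs_events es = concat (map (\<lambda>(a, \<beta>, \<alpha>). bvs \<beta> @ bvs \<alpha>) es)"

definition coherent :: "('f, 'n, 'v, 'p) event list set \<Rightarrow> bool" where
  "coherent Ss \<longleftrightarrow> (\<forall>s\<in>Ss. \<forall>s'\<in>Ss. s \<noteq> s' \<longrightarrow> fv_events s \<inter> fv_events s' = {})"

fun interleavings :: "'a list list \<Rightarrow> 'a list set" where
  "interleavings [] = {[]}"
| "interleavings (s # ss) = (\<Union>r\<in>interleavings ss. shuffles s r)"

definition update ::
  "'v set \<Rightarrow> 'f \<Rightarrow> ('f, 'n, 'v, 'p) knowledge \<Rightarrow> ('f, 'n, 'v, 'p) assn \<Rightarrow>
   ('f, 'n, 'v, 'p) knowledge" where
  "update Vq pk K \<alpha> = (fst K \<union> pubs Vq pk \<alpha>, insert \<alpha> (snd K))"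

text \<open>
  The data fixed in a run. Indexed components are meant for indices from \<open>1\<close> to the number of
  events (\<open>know\<close> also for \<open>0\<close>).
\<close>

record ('f, 'n, 'v, 'p) run =
  agents :: "'n set"
  intruder :: 'n
  init :: "'n \<Rightarrow> ('f, 'n, 'v) trm set"
  events :: "('f, 'n, 'v, 'p) event list"
  sg :: "('f, 'n, 'v) subst"
  know :: "nat \<Rightarrow> 'n \<Rightarrow> ('f, 'n, 'v, 'p) knowledge"
  XX :: "nat \<Rightarrow> ('f, 'n, 'v, 'p) assn set"
  mu :: "nat \<Rightarrow> ('f, 'n, 'v) subst"
  YY :: "nat \<Rightarrow> ('f, 'n, 'v, 'p) assn set"
  theta :: "nat \<Rightarrow> ('f, 'n, 'v) subst"
  spare :: 'n

definition actor :: "('f, 'n, 'v, 'p, 'z) run_scheme \<Rightarrow> nat \<Rightarrow> 'n" where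
  "actor r i = fst (events r ! (i - 1))"

definition rcv :: "('f, 'n, 'v, 'p, 'z) run_scheme \<Rightarrow> nat \<Rightarrow> ('f, 'n, 'v, 'p) assn" where
  "rcv r i = fst (snd (events r ! (i - 1)))"

definition snt :: "('f, 'n, 'v, 'p, 'z) run_scheme \<Rightarrow> nat \<Rightarrow> ('f, 'n, 'v, 'p) assn" where
  "snt r i = snd (snd (events r ! (i - 1)))"

definition is_run ::
  "'v set \<Rightarrow> 'f \<Rightarrow> 'f drule set \<Rightarrow> ('f, 'n, 'v, 'p) role set \<Rightarrow>
   ('f, 'n, 'v, 'p) run \<Rightarrow> bool" where
  "is_run Vq pk R Pr r \<longleftrightarrow>
     intruder r \<in> agents r \<and>
     (\<forall>a\<in>agents r. \<forall>t\<in>init r a. vars t = {}) \<and>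
     (\<exists>ss. distinct ss \<and> (\<forall>s\<in>set ss. is_session (agents r) Pr s) \<and> coherent (set ss) \<and>
        events r \<in> interleavings ss) \<and>
     fv_events (events r) \<inter> Vq = {} \<and>
     fv_events (events r) \<inter> set (bvs_events (events r)) = {} \<and>
     distinct (bvs_events (events r)) \<and>
     dom (sg r) = fv_events (events r) \<and> (\<forall>t\<in>ran (sg r). vars t = {}) \<and>
     (\<forall>a\<in>agents r. know r 0 a = (init r a, {})) \<and>
     (\<forall>i\<in>{1..length (events r)}.
        (\<forall>a\<in>agents r - {actor r i, intruder r}. know r i a = know r (i - 1) a) \<and>
        know r i (actor r i) = update Vq pk (know r (i - 1) (actor r i)) (rcv r i) \<and>
        know r i (intruder r) = update Vq pk (know r (i - 1) (intruder r)) (snt r i) \<and>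
        ded_a Vq pk R (know r i (actor r i)) (snt r i) \<and>
        ded_a Vq pk R (ksubst (sg r) (know r (i - 1) (intruder r))) (asubst (sg r) (rcv r i)))"

text \<open>The pairs \<open>(T\<^sub>i; E\<^sub>i)\<close> and \<open>(U\<^sub>i; F\<^sub>i)\<close>.\<close>

definition TE :: "('f, 'n, 'v, 'p, 'z) run_scheme \<Rightarrow> nat \<Rightarrow> ('f, 'n, 'v, 'p) knowledge" where
  "TE r i = ker (know r i (intruder r))"

definition UF :: "('f, 'n, 'v, 'p, 'z) run_scheme \<Rightarrow> nat \<Rightarrow> ('f, 'n, 'v, 'p) knowledge" where
  "UF r i = ker (know r i (actor r i))"

text \<open>
  The leaves \<open>X\<close> and the witnesses \<open>m\<close> for the bound variables in a derivation of the
  \<open>s\<close>-instance of \<open>\<gamma>\<close> from kernel \<open>K\<close>.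
\<close>

definition witnesses ::
  "'v set \<Rightarrow> 'f \<Rightarrow> 'f drule set \<Rightarrow> ('f, 'n, 'v) subst \<Rightarrow> ('f, 'n, 'v, 'p) knowledge \<Rightarrow>
   ('f, 'n, 'v, 'p) assn \<Rightarrow> ('f, 'n, 'v, 'p) assn set \<Rightarrow> ('f, 'n, 'v) subst \<Rightarrow> bool" where
  "witnesses Vq pk R s K \<gamma> X m \<longleftrightarrow>
     X \<subseteq> hat \<gamma> \<and> covers X \<gamma> \<and>
     dom m = bv \<gamma> - \<Union> (bv ` X) \<and>
     (\<forall>t\<in>ran m. dy R (tsubst s ` fst K) t) \<and>
     (\<forall>\<delta>\<in>X. ded_eq Vq pk R (ksubst s K) (asubst s (asubst m \<delta>)))"

definition run_witnesses ::
  "'v set \<Rightarrow> 'f \<Rightarrow> 'f drule set \<Rightarrow> ('f, 'n, 'v, 'p) run \<Rightarrow> bool" where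
  "run_witnesses Vq pk R r \<longleftrightarrow>
     (\<forall>i\<in>{1..length (events r)}.
        witnesses Vq pk R (sg r) (TE r (i - 1)) (rcv r i) (XX r i) (mu r i) \<and>
        witnesses Vq pk R (sg r) (UF r i) (snt r i) (YY r i) (theta r i))"

definition om :: "('f, 'n, 'v, 'p, 'z) run_scheme \<Rightarrow> ('f, 'n, 'v) subst" where
  "om r = foldl scomp (sg r) (concat (map (\<lambda>i. [mu r i, theta r i]) [1..<length (events r) + 1]))"

definition CC :: "'f \<Rightarrow> ('f, 'n, 'v, 'p, 'z) run_scheme \<Rightarrow> ('f, 'n, 'v) trm set" where
  "CC pk r =
     (\<Union>i\<le>length (events r). \<Union> (st ` fst (TE r i)) \<union> \<Union> (ast pk ` snd (TE r i))) \<union>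
     (\<Union>i\<in>{1..length (events r)}. \<Union> (st ` fst (UF r i)) \<union> \<Union> (ast pk ` snd (UF r i)))"

definition DD :: "'f \<Rightarrow> ('f, 'n, 'v, 'p, 'z) run_scheme \<Rightarrow> ('f, 'n, 'v) trm set" where
  "DD pk r = CC pk r - range Var"

section \<open>Zapping\<close>

definition spare_name :: "'f \<Rightarrow> ('f, 'n, 'v, 'p, 'z) run_scheme \<Rightarrow> bool" where
  "spare_name pk r \<longleftrightarrow>
     Nm (spare r) \<in> fst (TE r 0) \<and>
     (\<forall>i\<in>{1..length (events r)}.
        Nm (spare r) \<notin> ast pk (snt r i) \<union> ast pk (rcv r i) \<and>
        Nm (spare r) \<notin> \<Union> (st ` (ran (theta r i) \<union> ran (mu r i))))"

definition zappable :: "'f \<Rightarrow> ('f, 'n, 'v, 'p, 'z) run_scheme \<Rightarrow> ('f, 'n, 'v) trm \<Rightarrow> bool" where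
  "zappable pk r t \<longleftrightarrow>
     (\<exists>x\<in>dom (om r). tsubst (om r) t = tsubst (om r) (Var x) \<and>
        \<not> (\<exists>u\<in>DD pk r. tsubst (om r) (Var x) = tsubst (om r) u))"

fun zap ::
  "'f \<Rightarrow> ('f, 'n, 'v, 'p, 'z) run_scheme \<Rightarrow> ('f, 'n, 'v) trm \<Rightarrow> ('f, 'n, 'v) trm" where
  "zap pk r (Var x) = Var x"
| "zap pk r (Nm a) = (if zappable pk r (Nm a) then Nm (spare r) else Nm a)"
| "zap pk r (Fn f ts) =
     (if zappable pk r (Fn f ts) then Nm (spare r) else Fn f (map (zap pk r) ts))"

text \<open>Outside its domain a substitution is the identity, and zapping fixes variables.\<close>

definition star ::
  "'f \<Rightarrow> ('f, 'n, 'v, 'p, 'z) run_scheme \<Rightarrow> ('f, 'n, 'v) subst \<Rightarrow> ('f, 'n, 'v) subst" where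
  "star pk r l = (\<lambda>x. map_option (zap pk r) (l x))"

end

theory Submission
  imports Defs
begin

text \<open>Absorption rests on acyclicity: \<open>mu r i\<close> ranges over variables bound before
  step i, and \<open>theta r i\<close> also over those of the assertion just received, so no
  substitution reintroduces a variable of its own domain or of a later one. Zappability depends only
  on the value under \<open>\<omega>\<close>; this is why truth of an equality makes its two sides
  behave alike. Such truth is not among the data of a run. It is proved by following assertions back
  and forth between the intruder and the honest agents, and \<open>covers\<close> guarantees that
  each equality and list assertion inside a message is a leaf derived equationally. A destructor
  might also break at its side premises: an instance of a composed pattern can be zappable while the
  pattern keeps its shape. The subterm property leaves only metavariables and the major premise
  itself as side premises. That a received variable has a value within the reach of the intruder
  must be read off a derivation with quantifier rules, hence with fresh and renamed variables. These
  are all made available at first and later replaced by the spare name, which does not disturb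
  ground terms.\<close>

text \<open>
  The substitution \<open>\<omega>\<close> absorbs \<open>\<sigma>\<close>, \<open>\<mu>\<^sub>i\<close> and \<open>\<theta>\<^sub>i\<close>, so no instance of a nonvariable term of \<open>\<C>\<close>
  is zappable and zapping commutes with \<open>\<sigma>\<close> and \<open>\<sigma>\<mu>\<^sub>i\<close> on \<open>\<C>\<close>.

  For terms, a normal derivation is zapped step by step. Only a destructor with a zappable major
  premise breaks. The subterm property places such a premise inside some \<open>\<sigma>(x)\<close>, and \<open>x\<close> was
  received by an honest agent before the intruder could know it. So the intruder had constructed the
  premise from its arguments at an earlier stage, where induction applies.

  For equalities, every derivable equality holds under \<open>\<omega>\<close>; hence two equated terms are zappable
  together, and congruence survives zapping. Only projection from zappable terms breaks. It is
  eliminable: between congruence steps it amounts to an equality of two subterms of instances of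
  \<open>\<C>\<close>, and these are ground if zappable, hence identical. List assertions are tracked through the
  name they denote, as zapping identifies names and so does not commute with intersection of lists.
\<close>

section \<open>Terms and substitutions\<close>

lemma st_refl [simp]: "t \<in> st t"
  by (cases t) auto

lemma st_trans: "s \<in> st t \<Longrightarrow> t \<in> st u \<Longrightarrow> s \<in> st u"
  by (induction u) auto

lemma vars_st: "s \<in> st t \<Longrightarrow> vars s \<subseteq> vars t"
  by (induction t) auto

lemma var_in_st: "x \<in> vars t \<Longrightarrow> Var x \<in> st t"
  by (induction t) auto

lemma st_tsubst_mono: "s \<in> st t \<Longrightarrow> tsubst l s \<in> st (tsubst l t)"
  by (induction t) auto

lemma tsubst_cong: "(\<And>x. x \<in> vars t \<Longrightarrow> tsubst l (Var x) = tsubst l' (Var x)) \<Longrightarrow> tsubst l t = tsubst l' t"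
  by (induction t) auto

lemma tsubst_disjoint: "vars t \<inter> dom l = {} \<Longrightarrow> tsubst l t = t"
  by (induction t) (auto simp: disjoint_iff domIff intro!: map_idI)

lemma tsubst_ground: "vars t = {} \<Longrightarrow> tsubst l t = t"
  by (simp add: tsubst_disjoint)

lemma tsubst_pinst: "tsubst l (pinst \<rho> u) = pinst (tsubst l \<circ> \<rho>) u"
  by (induction u) auto

lemma tsubst_scomp: "tsubst (scomp l l') t = tsubst l (tsubst l' t)"
proof (induction t)
  case (Var x)
  then show ?case by (auto simp: scomp_def domIff)
qed auto

lemma st_tsubst:
  assumes "s \<in> st (tsubst l t)"
  shows "(\<exists>t'\<in>st t. (\<forall>x. t' \<noteq> Var x) \<and> s = tsubst l t') \<or> (\<exists>x\<in>vars t. s \<in> st (tsubst l (Var x)))"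
  using assms
proof (induction t)
  case (Fn f ts)
  show ?case
  proof (cases "s = tsubst l (Fn f ts)")
    case True
    then show ?thesis by (intro disjI1 bexI[of _ "Fn f ts"]) auto
  next
    case False
    then obtain t where t: "t \<in> set ts" "s \<in> st (tsubst l t)" using Fn.prems by auto
    from Fn.IH[OF t] t(1) show ?thesis by (auto intro: HOL.exI)
  qed
qed auto

section \<open>Term derivability\<close>

text \<open>\<open>HOL.exI\<close> is qualified because the rules of \<open>ded\<close> hide \<open>exI\<close>, \<open>sym\<close>, \<open>trans\<close> and \<open>subst\<close>.\<close>

lemma dy_ax: "t \<in> X \<Longrightarrow> dy R X t"
  unfolding dy_def by (rule HOL.exI[of _ "DAx t"]) simp

lemma dy_con:
  assumes "\<And>t. t \<in> set ts \<Longrightarrow> dy R X t"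
  shows "dy R X (Fn f ts)"
proof -
  have "\<forall>t\<in>set ts. \<exists>p. valid_proof R X p \<and> concl p = t" using assms by (auto simp: dy_def)
  then obtain h where h: "\<forall>t\<in>set ts. valid_proof R X (h t) \<and> concl (h t) = t" by metis
  then show ?thesis unfolding dy_def
    by (intro HOL.exI[of _ "DCon f (map h ts)"]) (auto simp: map_idI)
qed

lemma dy_des:
  assumes "(f, n, us, i) \<in> R" "i < n" "dy R X (Fn f (map \<rho> [0..<n]))"
    and "\<And>u. u \<in> set us \<Longrightarrow> dy R X (pinst \<rho> u)"
  shows "dy R X (\<rho> i)"
proof -
  from assms(3) obtain p where p: "valid_proof R X p" "concl p = Fn f (map \<rho> [0..<n])"
    by (auto simp: dy_def)
  have "\<forall>u\<in>set us. \<exists>p. valid_proof R X p \<and> concl p = pinst \<rho> u" using assms(4) by (auto simp: dy_def)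
  then obtain h where h: "\<forall>u\<in>set us. valid_proof R X (h u) \<and> concl (h u) = pinst \<rho> u" by metis
  show ?thesis unfolding dy_def
    by (intro HOL.exI[of _ "DDes (f, n, us, i) \<rho> p (map h us)"]) (use assms p h in auto)
qed

lemma dy_induct [consumes 1, case_names ax con des]:
  assumes "dy R X t"
    and "\<And>t. t \<in> X \<Longrightarrow> P t"
    and "\<And>f ts. (\<And>t. t \<in> set ts \<Longrightarrow> dy R X t) \<Longrightarrow> (\<And>t. t \<in> set ts \<Longrightarrow> P t) \<Longrightarrow> P (Fn f ts)"
    and "\<And>f n us i \<rho>. (f, n, us, i) \<in> R \<Longrightarrow> i < n \<Longrightarrow> P (Fn f (map \<rho> [0..<n])) \<Longrightarrow>
      (\<And>u. u \<in> set us \<Longrightarrow> P (pinst \<rho> u)) \<Longrightarrow> P (\<rho> i)"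
  shows "P t"
proof -
  have "valid_proof R X p \<Longrightarrow> P (concl p)" for p
  proof (induction p)
    case (DAx t)
    then show ?case using assms(2) by simp
  next
    case (DCon f ps)
    then have "dy R X t" "P t" if "t \<in> set (map concl ps)" for t using that by (auto simp: dy_def)
    then show ?case using assms(3)[of "map concl ps" f] by simp
  next
    case (DDes d \<rho> p ps)
    obtain f n us i where d: "d = (f, n, us, i)" by (cases d)
    have v: "(f, n, us, i) \<in> R" "i < n" "concl p = Fn f (map \<rho> [0..<n])"
      "map concl ps = map (pinst \<rho>) us" "valid_proof R X p" "\<forall>q\<in>set ps. valid_proof R X q"
      using DDes.prems unfolding d by auto
    have "P (pinst \<rho> u)" if "u \<in> set us" for u
    proof -
      have "pinst \<rho> u \<in> concl ` set ps" using that v(4) by (metis imageI list.set_map)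
      then show ?thesis using DDes.IH(2) v(6) by auto
    qed
    then show ?case using assms(4)[of f n us i \<rho>] DDes.IH(1) v d by simp
  qed
  then show ?thesis using assms(1) unfolding dy_def by blast
qed

lemma dy_mono: "dy R X t \<Longrightarrow> X \<subseteq> Y \<Longrightarrow> dy R Y t"
proof (induction rule: dy_induct)
  case (ax t)
  then show ?case by (auto intro: dy_ax)
next
  case (con f ts)
  then show ?case by (auto intro: dy_con)
next
  case (des f n us i \<rho>)
  then show ?case by (auto intro: dy_des[of f n us i R Y \<rho>])
qed

lemma dy_tsubst: "dy R X t \<Longrightarrow> dy R (tsubst l ` X) (tsubst l t)"
proof (induction rule: dy_induct)
  case (ax t)
  then show ?case by (auto intro: dy_ax)
next
  case (con f ts)
  then show ?case by (auto intro!: dy_con)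
next
  case (des f n us i \<rho>)
  then show ?case using dy_des[of f n us i R "tsubst l ` X" "tsubst l \<circ> \<rho>"]
    by (auto simp: tsubst_pinst comp_def)
qed

lemma dy_vars: "dy R X t \<Longrightarrow> vars t \<subseteq> (\<Union>s\<in>X. vars s)"
proof (induction rule: dy_induct)
  case (des f n us i \<rho>)
  then show ?case by fastforce
qed fastforce+

text \<open>
  Instantiating the metavariables by the two atoms \<open>a\<close> and \<open>x\<close> leaves no room for composed side
  premises inside the conclusion and the axioms, except for the major premise itself.
\<close>

lemma side_premise_cases:
  assumes sub: "subterm_property TYPE(('f, 'n, 'v) trm) R"
    and R: "(f, n, us, i) \<in> R" "i < n" and u: "u \<in> set us"
  shows "(\<exists>j. u = Meta j) \<or> u = PFn f (map Meta [0..<n])"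
proof (cases u)
  case (PFn g vs)
  obtain a :: 'n and x :: 'v where "True" by blast
  define atoms :: "('f, 'n, 'v) trm set" where "atoms = {Nm a, Var x}"
  have inst: "g = f \<and> map (pinst \<rho>) vs = map \<rho> [0..<n]" if \<rho>: "\<And>j. \<rho> j \<in> atoms" for \<rho>
  proof -
    define X where "X = insert (Fn f (map \<rho> [0..<n])) atoms"
    have "\<exists>p. valid_proof R X p \<and> normal_proof p \<and> concl p = pinst \<rho> v" for v
    proof (induction v)
      case (Meta j)
      then show ?case using \<rho>[of j] by (intro HOL.exI[of _ "DAx (\<rho> j)"]) (auto simp: X_def)
    next
      case (PFn h ws)
      then obtain k where "\<forall>v\<in>set ws. valid_proof R X (k v) \<and> normal_proof (k v) \<and> concl (k v) = pinst \<rho> v"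
        by metis
      then show ?case by (intro HOL.exI[of _ "DCon h (map k ws)"]) auto
    qed
    then obtain k where k: "\<And>v. valid_proof R X (k v) \<and> normal_proof (k v) \<and> concl (k v) = pinst \<rho> v"
      by metis
    \<comment> \<open>Taking the major premise as an axiom keeps this proof normal, as the subterm
      property requires.\<close>
    define p where "p = DDes (f, n, us, i) \<rho> (DAx (Fn f (map \<rho> [0..<n]))) (map k us)"
    have "valid_proof R X p" "normal_proof p" using R k by (auto simp: p_def X_def)
    then have "proof_terms p \<subseteq> \<Union> (st ` insert (concl p) X)"
      using sub unfolding subterm_property_def by blast
    moreover have "st w \<subseteq> insert (Fn f (map \<rho> [0..<n])) atoms" if "w \<in> insert (concl p) X" for w
    proof -
      have at: "st (\<rho> j) \<subseteq> atoms" for j using \<rho>[of j] by (auto simp: atoms_def)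
      from that consider "w \<in> atoms" | "w = Fn f (map \<rho> [0..<n])" | "w = \<rho> i"
        by (auto simp: X_def p_def)
      then show ?thesis using at by cases (auto simp: atoms_def)
    qed
    ultimately have sub': "proof_terms p \<subseteq> insert (Fn f (map \<rho> [0..<n])) atoms" by blast
    have "concl q \<in> proof_terms q" for q :: "('f, 'n, 'v) dproof" by (cases q) auto
    then have "concl (k u) \<in> proof_terms p" using u by (auto simp: p_def)
    then have "pinst \<rho> u \<in> insert (Fn f (map \<rho> [0..<n])) atoms" using k[of u] sub' by auto
    then show ?thesis using PFn by (auto simp: atoms_def)
  qed
  from inst[of "\<lambda>_. Nm a"] have g: "g = f"
    and "map (pinst (\<lambda>_. Nm a :: ('f, 'n, 'v) trm)) vs = map (\<lambda>_. Nm a) [0..<n]"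
    by (auto simp: atoms_def)
  then have len: "length vs = n" by (metis length_map length_upt minus_nat.diff_0)
  have "vs ! j = Meta j" if j: "j < n" for j
  proof -
    \<comment> \<open>Marking the \<open>j\<close>-th argument alone identifies the pattern in place
      \<open>j\<close>: only \<open>Meta j\<close> has the instance \<open>Var x\<close>.\<close>
    define \<rho> where "\<rho> = (\<lambda>l. if l = j then Var x else Nm a :: ('f, 'n, 'v) trm)"
    have "map (pinst \<rho>) vs ! j = map \<rho> [0..<n] ! j"
      using inst[of \<rho>] by (simp add: \<rho>_def atoms_def)
    then have "pinst \<rho> (vs ! j) = Var x" using j len by (simp add: \<rho>_def)
    then show ?thesis by (cases "vs ! j") (auto simp: \<rho>_def split: if_splits)
  qed
  then have "vs = map Meta [0..<n]" using len by (intro nth_equalityI) auto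
  then show ?thesis using PFn g by simp
qed simp

text \<open>In a normal proof the major premise of a destructor does not end in a constructor, so
  the subterm property places it among the subterms of \<open>X\<close>. This extra fact in the case
  \<open>des\<close> is what \<open>dy_induct\<close> cannot offer.\<close>

lemma dy_normal_induct [consumes 3, case_names ax con des]:
  assumes norm: "normalization TYPE(('f, 'n, 'v) trm) R"
    and sub: "subterm_property TYPE(('f, 'n, 'v) trm) R"
    and dy: "dy R X (t :: ('f, 'n, 'v) trm)"
    and "\<And>t. t \<in> X \<Longrightarrow> P t"
    and "\<And>f ts. (\<And>t. t \<in> set ts \<Longrightarrow> dy R X t) \<Longrightarrow> (\<And>t. t \<in> set ts \<Longrightarrow> P t) \<Longrightarrow> P (Fn f ts)"
    and "\<And>f n us i \<rho>. (f, n, us, i) \<in> R \<Longrightarrow> i < n \<Longrightarrow> Fn f (map \<rho> [0..<n]) \<in> \<Union> (st ` X) \<Longrightarrow>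
      P (Fn f (map \<rho> [0..<n])) \<Longrightarrow> (\<And>u. u \<in> set us \<Longrightarrow> P (pinst \<rho> u)) \<Longrightarrow> P (\<rho> i)"
  shows "P t"
proof -
  have cp: "concl q \<in> proof_terms q" for q :: "('f, 'n, 'v) dproof" by (cases q) auto
  have "valid_proof R X p \<Longrightarrow> normal_proof p \<Longrightarrow> P (concl p)" for p
  proof (induction p)
    case (DAx t)
    then show ?case using assms(4) by simp
  next
    case (DCon f ps)
    then have "dy R X t" "P t" if "t \<in> set (map concl ps)" for t using that by (auto simp: dy_def)
    then show ?case using assms(5)[of "map concl ps" f] by simp
  next
    case (DDes d \<rho> p ps)
    obtain f n us i where d: "d = (f, n, us, i)" by (cases d)
    have v: "(f, n, us, i) \<in> R" "i < n" "concl p = Fn f (map \<rho> [0..<n])"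
      "map concl ps = map (pinst \<rho>) us" "valid_proof R X p" "\<forall>q\<in>set ps. valid_proof R X q"
      using DDes.prems unfolding d by auto
    have "proof_terms p \<subseteq> \<Union> (st ` X)"
      using DDes.prems v(5) sub unfolding subterm_property_def by auto
    then have major: "Fn f (map \<rho> [0..<n]) \<in> \<Union> (st ` X)" using cp[of p] v(3) by auto
    have "P (pinst \<rho> u)" if "u \<in> set us" for u
    proof -
      have "pinst \<rho> u \<in> concl ` set ps" using that v(4) by (metis imageI list.set_map)
      then show ?thesis using DDes v(6) by auto
    qed
    then show ?case using assms(6)[of f n us i \<rho>] DDes v d major by simp
  qed
  then show ?thesis using norm dy unfolding normalization_def by blast
qed

text \<open>Axioms and conclusions of destructors lie among the subterms of \<open>X\<close>
  together with all their own subterms. A new subterm therefore arises at a constructor step, where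
  it is derived.\<close>

lemma dy_new_subterm:
  assumes "normalization TYPE(('f, 'n, 'v) trm) R" "subterm_property TYPE(('f, 'n, 'v) trm) R"
    and "dy R X (w :: ('f, 'n, 'v) trm)" "s \<in> st w" "s \<notin> \<Union> (st ` X)"
  shows "dy R X s"
  using assms
proof (induction rule: dy_normal_induct)
  case (con f ts)
  then show ?case by (auto intro: dy_con)
next
  case (des f n us i \<rho>)
  then have "\<rho> i \<in> st (Fn f (map \<rho> [0..<n]))" by (auto intro!: bexI[of _ i])
  then have "\<rho> i \<in> \<Union> (st ` X)" using des(3) by (metis UN_iff st_trans)
  then show ?case using des.prems by (auto intro: st_trans)
qed auto

text \<open>A term foreign to \<open>X\<close> is neither an axiom nor the result of a destructor,
  so a normal derivation of it ends with the constructor rule.\<close>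

lemma dy_new_arguments:
  assumes "normalization TYPE(('f, 'n, 'v) trm) R" "subterm_property TYPE(('f, 'n, 'v) trm) R"
    and "dy R X (Fn f ts :: ('f, 'n, 'v) trm)" "Fn f ts \<notin> \<Union> (st ` X)" "t \<in> set ts"
  shows "dy R X t"
proof -
  have "s = Fn f ts \<longrightarrow> dy R X t" if "dy R X s" for s
    using assms(1,2) that
  proof (induction rule: dy_normal_induct)
    case (ax s)
    then show ?case using assms(4) st_refl by blast
  next
    case (con g us)
    then show ?case using assms(5) by auto
  next
    case (des g n us i \<rho>)
    then have "\<rho> i \<in> st (Fn g (map \<rho> [0..<n]))" by (auto intro!: bexI[of _ i])
    then have "\<rho> i \<in> \<Union> (st ` X)" using des(3) by (metis UN_iff st_trans)
    then show ?case using assms(4) by auto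
  qed
  then show ?thesis using assms(3) by blast
qed

section \<open>Equational derivations\<close>

text \<open>The remaining forms count as true because, without the rules for connectives and says,
  no equality or list assertion is ever inferred from them.\<close>

fun assn_true :: "('f, 'n, 'v) subst \<Rightarrow> ('f, 'n, 'v, 'p) assn \<Rightarrow> bool" where
  "assn_true w (Eq t u) \<longleftrightarrow> tsubst w t = tsubst w u"
| "assn_true w (InList t ns) \<longleftrightarrow> tsubst w t \<in> Nm ` set ns"
| "assn_true w _ \<longleftrightarrow> True"

lemma trm_eq_Nil:
  fixes t u :: "('f, 'n, 'v) trm"
  shows "trm_eq [] t u \<longleftrightarrow> t = u"
proof (induction "[] :: ('v \<times> 'v) list" t u rule: trm_eq.induct)
  case (3 f ts g us)
  have "list_all2 (trm_eq []) ts us \<longleftrightarrow> list_all2 (=) ts us"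
    by (rule list.rel_cong) (use 3 in auto)
  then show ?case by (auto simp: list.rel_eq)
qed auto

lemma alpha_eq_Eq: "alpha_eq \<alpha> (Eq t u) \<longleftrightarrow> \<alpha> = Eq t u"
  by (cases \<alpha>) (auto simp: alpha_eq_def trm_eq_Nil)

lemma alpha_eq_InList: "alpha_eq \<alpha> (InList t ns) \<longleftrightarrow> \<alpha> = InList t ns"
  by (cases \<alpha>) (auto simp: alpha_eq_def trm_eq_Nil)

lemma alpha_eq_assn_true: "alpha_eq \<alpha> \<beta> \<Longrightarrow> assn_true w \<alpha> \<Longrightarrow> assn_true w \<beta>"
  by (cases \<beta>) (auto simp: alpha_eq_Eq alpha_eq_InList)

lemma chain_rel:
  assumes "2 \<le> length ts" "\<forall>j. Suc j < length ts \<longrightarrow> Q (ts ! j) (ts ! Suc j)"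
    and "\<And>a b c. Q a b \<Longrightarrow> Q b c \<Longrightarrow> Q a c"
  shows "Q (hd ts) (last ts)"
proof -
  have "Q (ts ! 0) (ts ! Suc j)" if "Suc j < length ts" for j
    using that
  proof (induction j)
    case 0
    then show ?case using assms(2) by auto
  next
    case (Suc j)
    then show ?case using assms(2,3) by (metis Suc_lessD)
  qed
  moreover obtain j where "length ts = Suc (Suc j)"
    using assms(1) by (metis Suc_le_D numeral_2_eq_2 Suc_le_mono)
  moreover have "ts \<noteq> []" using assms(1) by auto
  ultimately show ?thesis by (simp add: hd_conv_nth last_conv_nth)
qed

text \<open>Projection is sound because term constructors are injective; intersection is sound
  because a term has one value, and all the lists contain that name.\<close>

lemma ded_eq_sound:
  assumes "ded Vq pk R full S A \<alpha>" "\<not> full" "\<And>\<delta>. \<delta> \<in> A \<Longrightarrow> assn_true w \<delta>"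
  shows "assn_true w \<alpha>"
  using assms
proof (induction rule: ded.induct)
  case (ax \<alpha> A \<beta> S)
  then show ?case by (auto intro: alpha_eq_assn_true)
next
  case (cons S A ts us f)
  then have "list_all2 (\<lambda>t u. tsubst w t = tsubst w u) ts us"
    by (auto elim!: list_all2_mono)
  then have "map (tsubst w) ts = map (tsubst w) us"
    by (simp add: list_all2_conv_all_nth list_eq_iff_nth_eq)
  then show ?case by simp
next
  case (trans ts S A)
  then have "tsubst w (hd ts) = tsubst w (last ts)"
    by (intro chain_rel[where Q = "\<lambda>a b. tsubst w a = tsubst w b"]) auto
  then show ?case by simp
next
  case (proj S A f ts us i)
  then have "map (tsubst w) ts ! i = map (tsubst w) us ! i" by simp
  then show ?case using proj by simp
next
  case (int ls S A t ns)
  then have "\<forall>l\<in>set ls. tsubst w t \<in> Nm ` set l" by auto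
  moreover obtain l where "l \<in> set ls" using int(1) by (cases ls) auto
  ultimately obtain b where b: "tsubst w t = Nm b" by auto
  then have "\<forall>l\<in>set ls. b \<in> set l" using \<open>\<forall>l\<in>set ls. tsubst w t \<in> Nm ` set l\<close> by auto
  then show ?case using b int by auto
qed auto

text \<open>
  Equational derivations in which projection is not a primitive rule; \<open>K\<close> collects the equalities
  between subterms of the knowledge.
\<close>

inductive lifted :: "(('f, 'n, 'v) trm \<Rightarrow> bool) \<Rightarrow>
    (('f, 'n, 'v) trm \<Rightarrow> ('f, 'n, 'v) trm \<Rightarrow> bool) \<Rightarrow>
    ('f, 'n, 'v) trm \<Rightarrow> ('f, 'n, 'v) trm \<Rightarrow> bool" for D K where
  lifted_refl: "D s \<Longrightarrow> lifted D K s s"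
| lifted_cons: "list_all2 (lifted D K) ts us \<Longrightarrow> lifted D K (Fn f ts) (Fn f us)"
| lifted_core: "K s t \<Longrightarrow> lifted D K s t"
| lifted_trans: "lifted D K s t \<Longrightarrow> lifted D K t u \<Longrightarrow> lifted D K s u"

lemma lifted_sym:
  assumes "lifted D K s t" "\<And>c d. K c d \<Longrightarrow> K d c"
  shows "lifted D K t s"
  using assms
proof (induction rule: lifted.induct)
  case (lifted_cons ts us f)
  then have "list_all2 (lifted D K) us ts"
    by (auto simp: list_all2_conv_all_nth)
  then show ?case by (rule lifted.lifted_cons)
qed (auto intro: lifted.intros)

text \<open>Identical arguments need not be derivable, whereas \<open>lifted_refl\<close> demands
  \<open>D\<close>. Hence the reflexive closure on the arguments, and hence \<open>lifted\<close>
  for the whole terms is stored: it could not be rebuilt by congruence.\<close>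

inductive arg_step :: "(('f, 'n, 'v) trm \<Rightarrow> bool) \<Rightarrow>
    (('f, 'n, 'v) trm \<Rightarrow> ('f, 'n, 'v) trm \<Rightarrow> bool) \<Rightarrow>
    ('f, 'n, 'v) trm \<Rightarrow> ('f, 'n, 'v) trm \<Rightarrow> bool" for D K where
  arg_step_refl: "arg_step D K s s"
| arg_step_cons: "lifted D K (Fn f ts) (Fn f us) \<Longrightarrow> list_all2 (lifted D K)\<^sup>=\<^sup>= ts us \<Longrightarrow>
    arg_step D K (Fn f ts) (Fn f us)"

lemma arg_step_lifted: "arg_step D K s t \<Longrightarrow> s = t \<or> lifted D K s t"
  by (cases rule: arg_step.cases) auto

lemma arg_step_trans:
  assumes "arg_step D K s t" "arg_step D K t u"
  shows "arg_step D K s u"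
  using assms
proof (cases rule: arg_step.cases)
  case (arg_step_cons f ts us)
  note 1 = this
  from assms(2) show ?thesis
  proof (cases rule: arg_step.cases)
    case arg_step_refl
    then show ?thesis using assms by simp
  next
    case (arg_step_cons g ts' us')
    have "list_all2 (lifted D K)\<^sup>=\<^sup>= ts us'"
      by (rule list_all2_trans[of _ _ _ ts us us'])
        (use 1 arg_step_cons in \<open>auto intro: lifted_trans\<close>)
    moreover have "lifted D K s u"
      using arg_step_lifted[OF assms(1)] arg_step_lifted[OF assms(2)] 1 arg_step_cons
      by (auto intro: lifted_trans)
    ultimately show ?thesis using 1 arg_step_cons by (auto intro: arg_step.arg_step_cons)
  qed
qed auto

text \<open>
  By \<open>absorb\<close>, the part of a derivation between its first and its last use of \<open>K\<close> is again an
  instance of \<open>K\<close>.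
\<close>

lemma lifted_shape:
  assumes "lifted D K s t"
    and absorb: "\<And>c c' d d'. K c c' \<Longrightarrow> c' = d \<or> lifted D K c' d \<Longrightarrow> K d d' \<Longrightarrow> K c d'"
  shows "arg_step D K s t \<or> (\<exists>c d. arg_step D K s c \<and> K c d \<and> arg_step D K d t)"
  using assms(1)
proof (induction rule: lifted.induct)
  case (lifted_cons ts us f)
  then have 1: "list_all2 (lifted D K) ts us" by (auto elim: list_all2_mono)
  then have "list_all2 (lifted D K)\<^sup>=\<^sup>= ts us" by (auto elim: list_all2_mono)
  with 1 show ?case by (auto intro: arg_step_cons lifted.lifted_cons)
next
  case (lifted_trans s t u)
  then show ?case
  proof (elim disjE HOL.exE conjE, goal_cases)
    case (4 c d c' d')
    then have "K c d'"
      using absorb arg_step_lifted arg_step_trans by metis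
    then show ?case using 4 by blast
  qed (blast intro: arg_step_trans)+
qed (auto intro: arg_step_refl)

lemma top_abstractable:
  assumes "dy R X (Fn f ts)" "\<And>t. t \<in> set ts \<Longrightarrow> dy R X t" "j < length ts"
  shows "[j] \<in> tabs R X (Fn f ts)"
  using assms by (auto simp: tabs_def pos_def Cons_eq_append_conv)

lemma tabs_sub_at:
  assumes "p \<in> tabs R X t"
  shows "dy R X (sub_at t p)"
proof (cases p rule: rev_cases)
  case Nil
  then show ?thesis using assms by (auto simp: tabs_def)
next
  case (snoc q i)
  moreover have "q @ [i] \<in> pos t" using assms snoc by (simp add: tabs_def)
  ultimately show ?thesis using assms unfolding tabs_def by blast
qed

text \<open>
  \<open>Zp\<close> and \<open>z\<close> stand for zappability and zapping, \<open>w\<close> for \<open>\<omega>\<close>, \<open>(S; A)\<close> and \<open>(S'; A')\<close> for the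
  kernel under \<open>\<sigma>\<close> and under \<open>\<sigma>\<^sup>*\<close>, and \<open>Core\<close> for the subterms of instances of \<open>\<C>\<close>.
\<close>

locale zap_transfer =
  fixes Vq :: "'v set" and pk :: 'f and R :: "'f drule set"
    and S S' :: "('f, 'n, 'v) trm set" and A A' :: "('f, 'n, 'v, 'p) assn set"
    and w :: "('f, 'n, 'v) subst" and Zp :: "('f, 'n, 'v) trm \<Rightarrow> bool"
    and z :: "('f, 'n, 'v) trm \<Rightarrow> ('f, 'n, 'v) trm" and m :: 'n and Core :: "('f, 'n, 'v) trm set"
  assumes z_Nm: "z (Nm a) = (if Zp (Nm a) then Nm m else Nm a)"
    and z_Fn: "z (Fn f ts) = (if Zp (Fn f ts) then Nm m else Fn f (map z ts))"
    and Zp_cong: "tsubst w s = tsubst w t \<Longrightarrow> Zp s = Zp t"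
    and dy_z: "dy R S s \<Longrightarrow> dy R S' (z s)"
    and dy_spare: "dy R S' (Nm m)"
    and Core_arg: "Fn f ts \<in> Core \<Longrightarrow> t \<in> set ts \<Longrightarrow> t \<in> Core"
    and Core_Zp: "Fn f ts \<in> Core \<Longrightarrow> Zp (Fn f ts) \<Longrightarrow> vars (Fn f ts) = {}"
    and Eq_A: "Eq s t \<in> A \<Longrightarrow> {s, t} \<subseteq> Core \<and> dy R S s \<and> dy R S t \<and>
      tsubst w s = tsubst w t \<and> Eq (z s) (z t) \<in> A'"
    and InList_A: "InList s ns \<in> A \<Longrightarrow> s \<in> Core \<and> dy R S s \<and> tsubst w s \<in> Nm ` set ns \<and>
      InList (z s) ns \<in> A' \<and> (\<forall>a\<in>set ns. Nm a \<in> Core \<and> dy R S (Nm a) \<and> \<not> Zp (Nm a))"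
begin

abbreviation zded :: "('f, 'n, 'v, 'p) assn \<Rightarrow> bool" where
  "zded \<equiv> ded Vq pk R False S' A'"

text \<open>The invariants are what projection needs: \<open>Core\<close> makes zappable terms
  ground, derivability gives abstractable positions, truth under \<open>w\<close> makes zappability
  agree on both sides, and the last conjunct is the equality to be projected.\<close>

definition core_eq :: "('f, 'n, 'v) trm \<Rightarrow> ('f, 'n, 'v) trm \<Rightarrow> bool" where
  "core_eq s t \<longleftrightarrow> s \<in> Core \<and> t \<in> Core \<and> dy R S s \<and> dy R S t \<and>
     tsubst w s = tsubst w t \<and> zded (Eq (z s) (z t))"

abbreviation leq :: "('f, 'n, 'v) trm \<Rightarrow> ('f, 'n, 'v) trm \<Rightarrow> bool" where
  "leq \<equiv> lifted (dy R S) core_eq"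

lemma zded_trans: "zded (Eq s t) \<Longrightarrow> zded (Eq t u) \<Longrightarrow> zded (Eq s u)"
  using ded.trans[of "[s, t, u]" Vq pk R False S' A'] by (auto simp: less_Suc_eq nth_Cons')

lemma core_eq_sym: "core_eq s t \<Longrightarrow> core_eq t s"
  by (auto simp: core_eq_def intro: ded.sym)

lemma leq_sym: "leq s t \<Longrightarrow> leq t s"
  by (rule lifted_sym) (auto intro: core_eq_sym)

text \<open>In the congruence case truth under \<open>w\<close> makes both terms zappable or
  neither. If both are, each becomes the spare name and reflexivity suffices.\<close>

lemma leq_sound:
  assumes "leq s t"
  shows "dy R S s \<and> dy R S t \<and> tsubst w s = tsubst w t \<and> zded (Eq (z s) (z t))"
  using assms
proof (induction rule: lifted.induct)
  case (lifted_refl s)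
  then show ?case by (auto intro: ded.eq dy_z)
next
  case (lifted_cons ts us f)
  have len: "length ts = length us" using lifted_cons by (auto dest: list_all2_lengthD)
  have IH: "dy R S (ts ! j) \<and> dy R S (us ! j) \<and> tsubst w (ts ! j) = tsubst w (us ! j) \<and>
      zded (Eq (z (ts ! j)) (z (us ! j)))" if "j < length ts" for j
    using lifted_cons that by (auto simp: list_all2_conv_all_nth)
  have "map (tsubst w) ts = map (tsubst w) us" using IH len by (simp add: list_eq_iff_nth_eq)
  then have w: "tsubst w (Fn f ts) = tsubst w (Fn f us)" by simp
  have "zded (Eq (z (Fn f ts)) (z (Fn f us)))"
  proof (cases "Zp (Fn f ts)")
    case True
    then show ?thesis using Zp_cong[OF w] by (auto simp: z_Fn intro: ded.eq dy_spare)
  next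
    case False
    have "zded (Eq (Fn f (map z ts)) (Fn f (map z us)))"
      by (rule ded.cons) (use IH len in \<open>auto simp: list_all2_conv_all_nth\<close>)
    then show ?thesis using False Zp_cong[OF w] by (auto simp: z_Fn)
  qed
  moreover have "dy R S (Fn f ts)" "dy R S (Fn f us)"
    using IH len by (auto intro!: dy_con simp: in_set_conv_nth)
  ultimately show ?case using w by simp
next
  case (lifted_core s t)
  then show ?case by (simp add: core_eq_def)
next
  case (lifted_trans s t u)
  then show ?case by (auto intro: zded_trans)
qed

text \<open>Membership in \<open>Core\<close> is asked of the two ends only, so the connecting step
  may run through terms outside \<open>Core\<close>.\<close>

lemma core_eq_absorb:
  assumes "core_eq c c'" "c' = d \<or> leq c' d" "core_eq d d'"
  shows "core_eq c d'"
  using assms leq_sound[of c' d] unfolding core_eq_def by (auto intro: zded_trans)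

lemma core_eq_proj:
  assumes K: "core_eq (Fn f cs) (Fn f ds)" and len: "length cs = length ds" and i: "i < length cs"
    and dyc: "\<And>c. c \<in> set cs \<union> set ds \<Longrightarrow> dy R S c"
  shows "cs ! i = ds ! i \<or> core_eq (cs ! i) (ds ! i)"
proof (cases "Zp (Fn f cs)")
  \<comment> \<open>Zapping erases the arguments here, so projection cannot be replayed. Instead the
    two terms coincide, which is what the first disjunct of the claim is for.\<close>
  case True
  moreover have "Zp (Fn f ds)" using K True Zp_cong by (metis core_eq_def)
  ultimately have "vars (Fn f cs) = {}" "vars (Fn f ds) = {}" using K Core_Zp by (auto simp: core_eq_def)
  then have "Fn f cs = Fn f ds" using K tsubst_ground by (metis core_eq_def)
  then show ?thesis by simp
next
  case False
  moreover have "\<not> Zp (Fn f ds)" using K False Zp_cong by (metis core_eq_def)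
  ultimately have zK: "zded (Eq (Fn f (map z cs)) (Fn f (map z ds)))"
    and zdy: "dy R S' (Fn f (map z cs))" "dy R S' (Fn f (map z ds))"
    using K dy_z[of "Fn f cs"] dy_z[of "Fn f ds"] by (auto simp: core_eq_def z_Fn)
  have "zded (Eq (map z cs ! i) (map z ds ! i))"
  proof (rule ded.proj[OF zK])
    show "\<forall>j<length (map z cs). {[0, j], [1, j]}
        \<subseteq> aabs R S' (Eq (Fn f (map z cs)) (Fn f (map z ds)) :: ('f, 'n, 'v, 'p) assn)"
    proof (intro allI impI)
      fix j assume "j < length (map z cs)"
      then have "[j] \<in> tabs R S' (Fn f (map z cs))" "[j] \<in> tabs R S' (Fn f (map z ds))"
        using dyc dy_z len by (auto intro!: top_abstractable[OF zdy(1)] top_abstractable[OF zdy(2)])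
      then show "{[0, j], [1, j]}
        \<subseteq> aabs R S' (Eq (Fn f (map z cs)) (Fn f (map z ds)) :: ('f, 'n, 'v, 'p) assn)"
        by simp
    qed
  qed (use len i in auto)
  then have "zded (Eq (z (cs ! i)) (z (ds ! i)))" using len i by simp
  moreover have "map (tsubst w) cs = map (tsubst w) ds" using K by (simp add: core_eq_def)
  then have "tsubst w (cs ! i) = tsubst w (ds ! i)" using len i by (metis nth_map)
  ultimately have "core_eq (cs ! i) (ds ! i)"
    using K Core_arg dyc len i by (auto simp: core_eq_def)
  then show ?thesis ..
qed

text \<open>By \<open>lifted_shape\<close> at most one core equality is met at the root. The steps
  around it keep the head symbol and relate the arguments one by one, so only the middle equality
  has to be projected.\<close>

lemma leq_proj:
  assumes le: "leq (Fn f ts) (Fn f us)" and len: "length ts = length us" and i: "i < length ts"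
    and dyt: "\<And>t. t \<in> set ts \<union> set us \<Longrightarrow> dy R S t"
  shows "leq (ts ! i) (us ! i)"
proof -
  have arg: "\<exists>us. s = Fn f us \<and> length us = length ts \<and> (\<forall>j<length ts. ts ! j = us ! j \<or> leq (ts ! j) (us ! j))"
    if "arg_step (dy R S) core_eq (Fn f ts) s" for ts s
    using that by (cases rule: arg_step.cases) (auto simp: list_all2_conv_all_nth)
  have arg': "\<exists>us. s = Fn f us \<and> length us = length ts \<and> (\<forall>j<length ts. us ! j = ts ! j \<or> leq (us ! j) (ts ! j))"
    if "arg_step (dy R S) core_eq s (Fn f ts)" for ts s
    using that by (cases rule: arg_step.cases) (auto simp: list_all2_conv_all_nth)
  have "arg_step (dy R S) core_eq (Fn f ts) (Fn f us) \<or>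
      (\<exists>c d. arg_step (dy R S) core_eq (Fn f ts) c \<and> core_eq c d \<and> arg_step (dy R S) core_eq d (Fn f us))"
    by (rule lifted_shape[OF le]) (rule core_eq_absorb)
  then consider "arg_step (dy R S) core_eq (Fn f ts) (Fn f us)"
    | c d where "arg_step (dy R S) core_eq (Fn f ts) c" "core_eq c d" "arg_step (dy R S) core_eq d (Fn f us)"
    by blast
  then show ?thesis
  proof cases
    case 1
    then have "ts ! i = us ! i \<or> leq (ts ! i) (us ! i)" using arg[OF 1] i by auto
    moreover have "leq (ts ! i) (ts ! i)" using i dyt by (auto intro: lifted_refl)
    ultimately show ?thesis by auto
  next
    case (2 c d)
    obtain cs where c: "c = Fn f cs" "length cs = length ts" "\<forall>j<length ts. ts ! j = cs ! j \<or> leq (ts ! j) (cs ! j)"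
      using arg[OF 2(1)] by blast
    obtain ds where d: "d = Fn f ds" "length ds = length us" "\<forall>j<length us. ds ! j = us ! j \<or> leq (ds ! j) (us ! j)"
      using arg'[OF 2(3)] by blast
    \<comment> \<open>Derivability passes from the outer arguments to the inner ones, since both
      sides of \<open>leq\<close> are derivable.\<close>
    have "dy R S (cs ! j)" if "j < length ts" for j
      using c(3) dyt that leq_sound by (metis Un_iff nth_mem)
    moreover have "dy R S (ds ! j)" if "j < length us" for j
      using d(3) dyt that leq_sound by (metis Un_iff nth_mem)
    ultimately have "dy R S e" if "e \<in> set cs \<union> set ds" for e
      using that c(2) d(2) by (auto simp: in_set_conv_nth)
    then have mid: "cs ! i = ds ! i \<or> core_eq (cs ! i) (ds ! i)"
      using core_eq_proj[of f cs ds i] 2(2) c d len i by auto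
    have "leq (ts ! i) (ts ! i)" using dyt i by (auto intro: lifted_refl)
    moreover have "ts ! i = cs ! i \<or> leq (ts ! i) (cs ! i)" using c(3) i by blast
    ultimately have "leq (ts ! i) (cs ! i)" by auto
    with mid have "leq (ts ! i) (ds ! i)" by (auto intro: lifted_core lifted_trans)
    moreover have "ds ! i = us ! i \<or> leq (ds ! i) (us ! i)" using d(3) i len by simp
    ultimately show ?thesis by (auto intro: lifted_trans)
  qed
qed

section \<open>List assertions under zapping\<close>

text \<open>The anchor \<open>c\<close> is a term of \<open>Core\<close>, as \<open>t\<close> itself
  need not be one. The names of \<open>ms\<close> are fixed by zapping and lie in
  \<open>Core\<close>, so that promoting a singleton list yields an instance of
  \<open>core_eq\<close>.\<close>

definition anchored :: "('f, 'n, 'v) trm \<Rightarrow> ('f, 'n, 'v) trm \<Rightarrow> 'n list \<Rightarrow> bool" where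
  "anchored t c ms \<longleftrightarrow> leq t c \<and> c \<in> Core \<and> zded (InList (z c) ms) \<and> tsubst w c \<in> Nm ` set ms \<and>
     (\<forall>a\<in>set ms. Nm a \<in> Core \<and> dy R S (Nm a) \<and> \<not> Zp (Nm a))"

text \<open>A list obtained by weakening may contain zappable names, so no zapped assertion about
  \<open>ns\<close> itself is demanded. Either the term is already equated with one of the names, or
  a part of the list is anchored.\<close>

fun transferred :: "('f, 'n, 'v, 'p) assn \<Rightarrow> bool" where
  "transferred (Eq t u) \<longleftrightarrow> leq t u"
| "transferred (InList t ns) \<longleftrightarrow> (\<exists>a\<in>set ns. leq t (Nm a)) \<or>
     (\<exists>c ms. anchored t c ms \<and> set ms \<subseteq> set ns)"
| "transferred _ \<longleftrightarrow> True"

lemma transferred_prom: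
  assumes "transferred (InList t [a])"
  shows "leq t (Nm a)"
proof (cases "leq t (Nm a)")
  case False
  then obtain c ms where c: "leq t c" "c \<in> Core" "zded (InList (z c) ms)" "tsubst w c \<in> Nm ` set ms"
    "set ms \<subseteq> {a}" "\<forall>a\<in>set ms. Nm a \<in> Core \<and> dy R S (Nm a) \<and> \<not> Zp (Nm a)"
    using assms by (auto simp: anchored_def)
  then have ms: "set ms = {a}" by auto
  \<comment> \<open>The list \<open>ms\<close> may repeat \<open>a\<close>; intersecting the single
    list \<open>ms\<close> normalises it to the form that \<open>prom\<close> expects.\<close>
  have "zded (InList (z c) [a])"
    by (rule ded.int[of "[ms]"]) (use c(3) ms in auto)
  then have "zded (Eq (z c) (Nm a))" by (rule ded.prom)
  then have "core_eq c (Nm a)"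
    using c ms leq_sound[OF c(1)] by (auto simp: core_eq_def z_Nm)
  then show ?thesis using c(1) by (blast intro: lifted_core lifted_trans)
qed

text \<open>The value of \<open>t\<close> under \<open>w\<close> is one name \<open>b\<close> common
  to all lists. If \<open>t\<close> is equated with any name, that name is \<open>b\<close> and
  belongs to the intersection. Otherwise all anchors are equal to one another, and the list
  assertions are moved to one of them and intersected there.\<close>

lemma transferred_int:
  assumes "ls \<noteq> []" and ls: "\<forall>l\<in>set ls. transferred (InList t l)"
    and ns: "set ns = \<Inter> (set ` set ls)"
    and w: "\<forall>l\<in>set ls. tsubst w t \<in> Nm ` set l"
  shows "transferred (InList t ns)"
proof -
  obtain l0 where l0: "l0 \<in> set ls" using assms(1) by (cases ls) auto
  then obtain b where b: "tsubst w t = Nm b" using w by auto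
  then have bl: "\<forall>l\<in>set ls. b \<in> set l" using w by auto
  show ?thesis
  proof (cases "\<exists>l\<in>set ls. \<exists>a\<in>set l. leq t (Nm a)")
    case True
    then obtain a where a: "leq t (Nm a)" by blast
    moreover have "a = b" using leq_sound[OF a] b by simp
    ultimately show ?thesis using bl ns by auto
  next
    case False
    then have "\<forall>l\<in>set ls. \<exists>c ms. anchored t c ms \<and> set ms \<subseteq> set l" using ls by auto
    then obtain C M where CM: "\<forall>l\<in>set ls. anchored t (C l) (M l) \<and> set (M l) \<subseteq> set l" by metis
    define c where "c = C l0"
    have le: "leq c (C l)" if "l \<in> set ls" for l
      using CM l0 that leq_sym lifted_trans unfolding anchored_def c_def by metis
    have zM: "zded (InList (z c) (M l))" if "l \<in> set ls" for l
    proof (rule ded.subst)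
      show "zded (InList (z (C l)) (M l))" using CM that by (auto simp: anchored_def)
      show "zded (Eq (z (C l)) (z c))" using leq_sound[OF leq_sym[OF le[OF that]]] by simp
    qed
    \<comment> \<open>The anchored lists may have a smaller intersection than \<open>ns\<close>. It
      still contains \<open>b\<close>, by truth under \<open>w\<close>.\<close>
    define ms where "ms = filter (\<lambda>a. \<forall>l\<in>set ls. a \<in> set (M l)) (M l0)"
    have "set ms = \<Inter> (set ` set (map M ls))" using l0 by (auto simp: ms_def)
    then have "zded (InList (z c) ms)"
      by (intro ded.int[of "map M ls"]) (use assms(1) zM in auto)
    moreover have tc: "leq t c" using CM l0 by (auto simp: anchored_def c_def)
    moreover have "b \<in> set (M l)" if "l \<in> set ls" for l
      using CM that b leq_sound unfolding anchored_def by (metis imageE trm.inject(2))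
    then have "b \<in> set ms" using l0 by (simp add: ms_def)
    then have "tsubst w c \<in> Nm ` set ms" using leq_sound[OF tc] b by (metis imageI)
    moreover have "set ms \<subseteq> set ns" using CM by (auto simp: ms_def ns anchored_def)
    moreover have "c \<in> Core" "\<forall>a\<in>set ms. Nm a \<in> Core \<and> dy R S (Nm a) \<and> \<not> Zp (Nm a)"
      using CM l0 by (auto simp: ms_def anchored_def c_def)
    ultimately have "anchored t c ms \<and> set ms \<subseteq> set ns" by (simp add: anchored_def)
    then show ?thesis by auto
  qed
qed

lemma assn_true_A: "\<delta> \<in> A \<Longrightarrow> assn_true w \<delta>"
  using Eq_A InList_A by (cases \<delta>) auto

text \<open>The knowledge is left variable and tied to \<open>S\<close> and \<open>A\<close> by
  equations because \<open>ded\<close> may extend it in \<open>exE\<close>;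
  \<open>\<not> full\<close> discards that rule and the other logical ones.\<close>

lemma ded_transferred:
  assumes "ded Vq pk R full S0 A0 \<alpha>" "\<not> full" "S0 = S" "A0 = A"
  shows "transferred \<alpha>"
  using assms
proof (induction rule: ded.induct)
  case (ax \<alpha> A0 \<beta> S0)
  then have ax': "\<alpha> \<in> A" "alpha_eq \<alpha> \<beta>" by auto
  show ?case
  proof (cases \<beta>)
    case (Eq t u)
    then have "Eq t u \<in> A" using ax' by (simp add: alpha_eq_Eq)
    then have "core_eq t u" using Eq_A by (auto simp: core_eq_def alpha_eq_Eq intro!: ded.ax)
    then show ?thesis using Eq by (auto intro: lifted_core)
  next
    case (InList t ns)
    then have I: "InList t ns \<in> A" using ax' by (simp add: alpha_eq_InList)
    then have "leq t t" using InList_A by (auto intro: lifted_refl)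
    moreover have "zded (InList (z t) ns)"
      using InList_A[OF I] by (auto simp: alpha_eq_InList intro!: ded.ax)
    ultimately have "anchored t t ns" using InList_A[OF I] by (simp add: anchored_def)
    then show ?thesis using InList by auto
  qed auto
next
  case (eq S0 t A0)
  then show ?case by (auto intro: lifted_refl)
next
  case (cons S0 A0 ts us f)
  then have "list_all2 leq ts us" by (auto elim!: list_all2_mono)
  then show ?case by (auto intro: lifted_cons)
next
  case (sym S0 A0 t u)
  then show ?case by (auto intro: leq_sym)
next
  case (trans ts S0 A0)
  then have "leq (hd ts) (last ts)"
    by (intro chain_rel[where Q = leq]) (auto intro: lifted_trans)
  then show ?case by simp
next
  case (proj S0 A0 f ts us i)
  \<comment> \<open>Abstractability of the argument positions supplies the derivability that
    \<open>leq_proj\<close> asks for.\<close>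
  have args: "dy R S (ts ! j) \<and> dy R S (us ! j)" if "j < length ts" for j
  proof -
    have "[j] \<in> tabs R S (Fn f ts)" "[j] \<in> tabs R S (Fn f us)"
      using proj that by auto
    then show ?thesis using tabs_sub_at by force
  qed
  have "leq (ts ! i) (us ! i)"
    by (rule leq_proj) (use proj args in \<open>auto simp: in_set_conv_nth\<close>)
  then show ?case by simp
next
  case (subst S0 A0 t ns u)
  then have "leq u t" by (auto intro: leq_sym)
  then have tr: "leq u c" if "leq t c" for c using that by (rule lifted_trans)
  have "(\<exists>a\<in>set ns. leq t (Nm a)) \<or> (\<exists>c ms. anchored t c ms \<and> set ms \<subseteq> set ns)"
    using subst by simp
  then show ?case
  proof
    assume "\<exists>a\<in>set ns. leq t (Nm a)"
    then show ?thesis using tr by auto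
  next
    assume "\<exists>c ms. anchored t c ms \<and> set ms \<subseteq> set ns"
    then obtain c ms where "anchored t c ms" "set ms \<subseteq> set ns" by blast
    then have "anchored u c ms" using tr by (simp add: anchored_def)
    then show ?thesis using \<open>set ms \<subseteq> set ns\<close> by auto
  qed
next
  case (prom S0 A0 t a)
  then have "transferred (InList t [a])" by blast
  then show ?case by (simp only: transferred.simps(1) transferred_prom)
next
  case (int ls S0 A0 t ns)
  have sound: "tsubst w t \<in> Nm ` set l" if "l \<in> set ls" for l
  proof -
    have "ded Vq pk R full S0 A0 (InList t l)" using int that by blast
    from ded_eq_sound[OF this, of w] show ?thesis using int.prems assn_true_A by simp
  qed
  have "\<forall>l\<in>set ls. transferred (InList t l)" using int by blast
  with int.hyps(1) show ?case
    by (rule transferred_int) (use int.hyps(2) sound in blast)+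
next
  case (wk S0 A0 t a ns)
  then show ?case by auto
qed auto

theorem ded_zap:
  assumes "ded Vq pk R False S A (Eq s t)"
  shows "zded (Eq (z s) (z t))"
  using ded_transferred[OF assms] leq_sound by simp

end

section \<open>Terms occurring in assertions\<close>

lemma bv_simps [simp]:
  "bv (Eq t u) = {}" "bv (Pred P us) = {}" "bv (InList t ns) = {}"
  "bv (And \<alpha> \<beta>) = bv \<alpha> \<union> bv \<beta>" "bv (Ex x \<alpha>) = insert x (bv \<alpha>)" "bv (Says k \<alpha>) = bv \<alpha>"
  by (auto simp: bv_def)

lemma set_bvs [simp]: "set (bvs \<alpha>) = bv \<alpha>"
  by (simp add: bv_def)

lemma bvs_asubst [simp]: "bvs (asubst l \<alpha>) = bvs \<alpha>"
  by (induction \<alpha> arbitrary: l) auto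

lemma vars_aterms: "t \<in> aterms pk \<alpha> \<Longrightarrow> vars t \<subseteq> fv \<alpha> \<union> bv \<alpha>"
  by (induction \<alpha>) auto

lemma fv_asubst_ground:
  fixes \<alpha> :: "('f, 'n, 'v, 'p) assn"
  assumes "\<And>t. t \<in> ran l \<Longrightarrow> vars t = {}"
  shows "fv (asubst l \<alpha>) = fv \<alpha> - dom l"
proof -
  have v: "vars (tsubst l t) = vars t - dom l" if "\<And>t. t \<in> ran l \<Longrightarrow> vars t = {}"
    for l and t :: "('f, 'n, 'v) trm"
    using that by (induction t) (auto simp: ran_def domIff split: option.splits)
  show ?thesis using assms
  proof (induction \<alpha> arbitrary: l)
    case (Ex x \<alpha>)
    then have "\<And>t. t \<in> ran (l(x := None)) \<Longrightarrow> vars t = {}" by (auto simp: ran_def split: if_splits)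
    then have "fv (asubst (l(x := None)) \<alpha>) = fv \<alpha> - dom (l(x := None))" by (rule Ex.IH)
    then show ?case by auto
  qed (auto simp: v)
qed

lemma wf_assn_bv: "wf_assn Vq \<alpha> \<Longrightarrow> bv \<alpha> \<subseteq> Vq"
  by (induction \<alpha>) auto

lemma aterms_asubst:
  "bv \<alpha> \<inter> dom l = {} \<Longrightarrow> aterms pk (asubst l \<alpha>) = tsubst l ` aterms pk \<alpha>"
proof (induction \<alpha>)
  case (Ex x \<alpha>)
  then have "l(x := None) = l" by (auto simp: domIff)
  then show ?case using Ex by auto
qed (auto simp: image_Un image_image Int_Un_distrib2)

lemma fv_st_asubst:
  assumes "x \<in> fv \<alpha>" "l x = Some g"
  shows "\<exists>t\<in>aterms pk (asubst l \<alpha>). g \<in> st t"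
proof -
  have v: "g \<in> st (tsubst l t)" if "x \<in> vars t" "l x = Some g" for l t
    using st_tsubst_mono[OF var_in_st[OF that(1)], of l] that(2) by simp
  show ?thesis using assms
    by (induction \<alpha> arbitrary: l) (auto simp: v dest: v)
qed

lemma at_terms: "\<gamma> \<in> at \<alpha> \<Longrightarrow> aterms pk \<gamma> \<subseteq> aterms pk \<alpha>"
  by (induction \<alpha>) auto

text \<open>Only a says-assertion can be assembled from its body instead of being a leaf.\<close>

lemma covers_at: "covers X \<alpha> \<Longrightarrow> \<gamma> \<in> at \<alpha> \<Longrightarrow> (\<forall>k \<delta>. \<gamma> \<noteq> Says k \<delta>) \<Longrightarrow> \<gamma> \<in> X"
  by (induction \<alpha>) auto

text \<open>Above its maximal public subterms and its quantified variables a term consists of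
  constructors only.\<close>

lemma dy_from_pubs:
  assumes "\<And>s. s \<in> tpubs Vq t \<Longrightarrow> dy R X (tsubst l s)"
    and "\<And>x. x \<in> vars t \<Longrightarrow> x \<in> Vq \<Longrightarrow> dy R X (tsubst l (Var x))"
  shows "dy R X (tsubst l t)"
  using assms
proof (induction t)
  case (Fn f ts)
  show ?case
  proof (cases "vars (Fn f ts) \<inter> Vq = {}")
    case True
    then show ?thesis using Fn.prems(1)[of "Fn f ts"] by simp
  next
    case False
    then have "dy R X (tsubst l t)" if "t \<in> set ts" for t
      using Fn.IH[OF that] Fn.prems that by (metis UN_I tpubs.simps(3) trm.set_intros)
    then show ?thesis by (auto intro!: dy_con)
  qed
next
  case (Var x)
  then show ?case by (cases "x \<in> Vq") auto
qed auto

lemma vars_tpubs: "s \<in> tpubs Vq t \<Longrightarrow> vars s \<subseteq> vars t - Vq"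
  by (induction t) (auto split: if_splits)

lemma st_pubs: "s \<in> pubs Vq pk \<alpha> \<Longrightarrow> \<exists>t\<in>aterms pk \<alpha>. s \<in> tpubs Vq t"
  by (auto simp: pubs_def)

section \<open>Terms of derivable assertions are derivable\<close>

text \<open>
  Axioms are used up to renaming of bound variables; adding all variables to \<open>X\<close>, which is
  otherwise ground, makes derivability invariant under such renamings.
\<close>

definition vground :: "('f, 'n, 'v) trm set \<Rightarrow> bool" where
  "vground X \<longleftrightarrow> (\<forall>s\<in>X. vars s = {} \<or> (\<exists>x. s = Var x))"

abbreviation with_vars :: "('f, 'n, 'v) trm set \<Rightarrow> ('f, 'n, 'v) trm set" where
  "with_vars X \<equiv> X \<union> range Var"

lemma dy_rename:
  assumes "vground X" "dy R (with_vars X) t"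
  shows "dy R (with_vars X) (tsubst (\<lambda>x. map_option Var (h x)) t)"
proof (rule dy_mono[OF dy_tsubst[OF assms(2)]])
  show "tsubst (\<lambda>x. map_option Var (h x)) ` with_vars X \<subseteq> with_vars X"
  proof (rule image_subsetI)
    fix s assume "s \<in> with_vars X"
    then consider x where "s = Var x" | "s \<in> X" "vars s = {}"
      using assms(1) by (auto simp: vground_def)
    then show "tsubst (\<lambda>x. map_option Var (h x)) s \<in> with_vars X"
    proof cases
      case (1 x)
      then show ?thesis by (cases "h x") auto
    next
      case 2
      then show ?thesis by (simp add: tsubst_ground)
    qed
  qed
qed

text \<open>The pairing of variables is functional, so one renaming serves all terms compared under
  the same binders.\<close>

lemma trm_eq_rename: "\<exists>h. \<forall>t u. trm_eq e t u \<longrightarrow> u = tsubst (\<lambda>x. map_option Var (h x)) t"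
proof -
  have var: "var_eq e x y \<Longrightarrow> var_eq e x y' \<Longrightarrow> y = y'" for x y y'
  proof (induction e)
    case (Cons p e)
    obtain a b where "p = (a, b)" by (cases p)
    with Cons show ?case by (cases "x = a"; cases "y = b"; cases "y' = b") simp_all
  qed simp
  define h where "h x = Some (THE y. var_eq e x y)" for x
  have h: "var_eq e x y \<Longrightarrow> h x = Some y" for x y
    unfolding h_def using var by (metis the_equality)
  have "trm_eq e t u \<Longrightarrow> u = tsubst (\<lambda>x. map_option Var (h x)) t" for t u
  proof (induction t arbitrary: u)
    case (Var x)
    then show ?case by (cases u) (auto simp: h)
  next
    case (Nm a)
    then show ?case by (cases u) auto
  next
    case (Fn f ts)
    then obtain us where u: "u = Fn f us" "list_all2 (trm_eq e) ts us" by (cases u) auto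
    then have "us = map (tsubst (\<lambda>x. map_option Var (h x))) ts"
      using Fn.IH by (auto simp: list_eq_iff_nth_eq list_all2_conv_all_nth)
    then show ?case using u by simp
  qed
  then show ?thesis by blast
qed

text \<open>The list of binders grows inside the assertion, so its terms may need different
  renamings; \<open>h\<close> is chosen for each term.\<close>

lemma alpha_env_terms:
  fixes \<alpha> \<beta> :: "('f, 'n, 'v, 'p) assn"
  assumes "alpha_env e \<alpha> \<beta>" "u \<in> aterms pk \<beta>"
  shows "\<exists>t\<in>aterms pk \<alpha>. \<exists>h. u = tsubst (\<lambda>x. map_option Var (h x)) t"
proof -
  have list: "\<exists>t\<in>set ts. \<exists>h. u = tsubst (\<lambda>x. map_option Var (h x)) t"
    if "list_all2 (trm_eq e) ts us" "u \<in> set us" for e ts us and u :: "('f, 'n, 'v) trm"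
    using that trm_eq_rename[of e] by (metis in_set_conv_nth list_all2_conv_all_nth)
  have one: "\<exists>h. u = tsubst (\<lambda>x. map_option Var (h x)) t"
    if "trm_eq e t u" for e t and u :: "('f, 'n, 'v) trm"
    using that trm_eq_rename[of e] by blast
  show ?thesis using assms
  proof (induction e \<alpha> \<beta> rule: alpha_env.induct)
    case (1 e t v t' v')
    then have "trm_eq e t t'" "trm_eq e v v'" by auto
    from this[THEN one] show ?case using 1 by auto
  next
    case (2 e P us Q vs)
    then show ?case using list by auto
  next
    case (3 e t ns t' ms)
    have "Nm b = tsubst (\<lambda>x. map_option Var (None :: 'v option)) (Nm b)" for b :: 'n by simp
    with 3 show ?case using one by auto
  next
    case (6 e k \<alpha> l \<beta>)
    show ?case
    proof (cases "u = Fn pk [l]")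
      case True
      have "trm_eq e k l" using 6 by simp
      from one[OF this] obtain h where "l = tsubst (\<lambda>x. map_option Var (h x)) k" by blast
      then have "u = tsubst (\<lambda>x. map_option Var (h x)) (Fn pk [k])" using True by simp
      then show ?thesis by auto
    next
      case False
      then show ?thesis using 6 by auto
    qed
  qed auto
qed

lemma repl_var:
  "repl t {p \<in> pos t. sub_at t p = Var x} r = tsubst (\<lambda>y. if y = x then Some r else None) t"
proof (induction t)
  case (Fn f ts)
  have "repl (ts ! i) {p. i # p \<in> {p \<in> pos (Fn f ts). sub_at (Fn f ts) p = Var x}} r = tsubst (\<lambda>y. if y = x then Some r else None) (ts ! i)"
    if "i < length ts" for i
  proof -
    have "{p. i # p \<in> {p \<in> pos (Fn f ts). sub_at (Fn f ts) p = Var x}} = {p \<in> pos (ts ! i). sub_at (ts ! i) p = Var x}"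
      using that by (auto simp: pos_def)
    then show ?thesis using Fn.IH[of "ts ! i"] that by simp
  qed
  then have "map (\<lambda>i. repl (ts ! i) {p. i # p \<in> {p \<in> pos (Fn f ts). sub_at (Fn f ts) p = Var x}} r) [0..<length ts]
      = map (\<lambda>i. tsubst (\<lambda>y. if y = x then Some r else None) (ts ! i)) [0..<length ts]"
    by (intro map_cong) (simp_all only: set_upt atLeastLessThan_iff)
  also have "\<dots> = map (tsubst (\<lambda>y. if y = x then Some r else None)) ts"
    by (intro nth_equalityI) simp_all
  finally show ?case by simp
qed (auto simp: pos_def)

lemma Cons_apos_of:
  "{p. 0 # p \<in> apos_of pk x (Eq t u)} = {p \<in> pos t. sub_at t p = Var x}"
  "{p. Suc 0 # p \<in> apos_of pk x (Eq t u)} = {p \<in> pos u. sub_at u p = Var x}"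
  "{p. 0 # p \<in> apos_of pk x (And \<alpha> \<beta>)} = apos_of pk x \<alpha>"
  "{p. Suc 0 # p \<in> apos_of pk x (And \<alpha> \<beta>)} = apos_of pk x \<beta>"
  "{p. 0 # p \<in> apos_of pk x (Ex y \<alpha>)} = apos_of pk x \<alpha>"
  "{p. Suc 0 # p \<in> apos_of pk x (Says k \<alpha>)} = apos_of pk x \<alpha>"
  by (auto simp: apos_of_def)

lemma Cons_aabs:
  "{p. 0 # p \<in> aabs R X (Eq t u)} = tabs R X t"
  "{p. Suc 0 # p \<in> aabs R X (Eq t u)} = tabs R X u"
  "{p. 0 # p \<in> aabs R X (And \<alpha> \<beta>)} = aabs R X \<alpha>"
  "{p. Suc 0 # p \<in> aabs R X (And \<alpha> \<beta>)} = aabs R X \<beta>"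
  "{p. 0 # p \<in> aabs R X (Ex y \<alpha>)} = aabs R (insert (Var y) X) \<alpha>"
  "{p. Suc 0 # p \<in> aabs R X (Says k \<alpha>)} = aabs R X \<alpha>"
  by auto

text \<open>Outside equalities a position addresses a whole argument only, so an argument containing
  \<open>x\<close> properly inside is left as it is; hence the two alternatives.\<close>

lemma arepl_terms:
  assumes "u \<in> aterms pk (arepl \<alpha> (apos_of pk x \<alpha>) r)"
  shows "\<exists>t\<in>aterms pk \<alpha>. u = t \<or> u = tsubst (\<lambda>y. if y = x then Some r else None) t"
  using assms
proof (induction \<alpha>)
  case (Eq t v)
  then show ?case by (auto simp: Cons_apos_of repl_var)
next
  case (Pred P us)
  then obtain i where i: "i < length us" "u = (if [i] \<in> apos_of pk x (Pred P us) then r else us ! i)"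
    by auto
  then have "us ! i \<in> aterms pk (Pred P us)" by simp
  with i show ?case by (cases "us ! i = Var x") (auto simp: apos_of_def intro!: bexI[of _ "us ! i"])
next
  case (InList t ns)
  then show ?case by (auto simp: apos_of_def split: if_splits)
next
  case (Says k \<alpha>)
  then show ?case by (auto simp: Cons_apos_of) (auto simp: apos_of_def split: if_splits)
qed (auto simp: Cons_apos_of)

text \<open>An abstractable position presupposes that the whole term is derivable. So a side of an
  equality in which \<open>x\<close> occurs is derivable outright, and one without \<open>x\<close>
  is unchanged by the replacement. \<open>X\<close> is arbitrary because a quantifier adds its
  variable, while \<open>Z\<close> contains all variables already.\<close>

lemma arepl_terms_conv:
  fixes x :: 'v and \<alpha> :: "('f, 'n, 'v, 'p) assn"
  assumes "apos_of pk x \<alpha> \<subseteq> aabs R X \<alpha>" "t \<in> aterms pk \<alpha>" "X \<subseteq> Z" "range Var \<subseteq> Z"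
    and "\<And>u. u \<in> aterms pk (arepl \<alpha> (apos_of pk x \<alpha>) r) \<Longrightarrow> dy R Z u"
  shows "dy R Z t"
proof -
  have occ: "x \<notin> vars t \<or> (\<exists>p\<in>pos t. sub_at t p = Var x)" for t :: "('f, 'n, 'v) trm"
  proof (induction t)
    case (Fn f ts)
    show ?case
    proof (cases "x \<in> vars (Fn f ts)")
      case True
      then obtain i where i: "i < length ts" "x \<in> vars (ts ! i)" by (auto simp: in_set_conv_nth)
      then obtain p where "p \<in> pos (ts ! i)" "sub_at (ts ! i) p = Var x" using Fn.IH[of "ts ! i"] by auto
      then show ?thesis using i by (intro disjI2 bexI[of _ "i # p"]) (auto simp: pos_def)
    qed simp
  next
    case (Var y)
    show ?case by (cases "y = x") (auto simp: pos_def intro!: HOL.exI[of _ "[]"])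
  qed (auto simp: pos_def)
  have whole: "dy R Z t"
    if sub: "{p \<in> pos t. sub_at t p = Var x} \<subseteq> tabs R X t" and "X \<subseteq> Z" "dy R Z (tsubst (\<lambda>y. if y = x then Some r else None) t)" for t X
  proof (cases "x \<in> vars t")
    case True
    then obtain p where "p \<in> tabs R X t" using occ[of t] sub by auto
    then have "dy R X t" by (auto simp: tabs_def)
    then show ?thesis using that dy_mono by blast
  next
    case False
    then have "tsubst (\<lambda>y. if y = x then Some r else None) t = t"
      by (intro tsubst_disjoint) (auto split: if_splits)
    then show ?thesis using that by simp
  qed
  have var: "dy R Z (Var y)" for y using assms(4) by (auto intro: dy_ax)
  have part: "{p. i # p \<in> apos_of pk x \<gamma>} \<subseteq> {p. i # p \<in> aabs R X \<gamma>}"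
    if "apos_of pk x \<gamma> \<subseteq> aabs R X \<gamma>" for i X and \<gamma> :: "('f, 'n, 'v, 'p) assn"
    using that by blast
  show ?thesis using assms(1-3,5)
  proof (induction \<alpha> arbitrary: X)
    case (Eq t1 t2)
    have "{p \<in> pos t1. sub_at t1 p = Var x} \<subseteq> tabs R X t1" "{p \<in> pos t2. sub_at t2 p = Var x} \<subseteq> tabs R X t2"
      using part[OF Eq.prems(1), of 0] part[OF Eq.prems(1), of "Suc 0"]
      by (simp_all only: Cons_apos_of Cons_aabs)
    moreover have "dy R Z (tsubst (\<lambda>y. if y = x then Some r else None) t1)"
      "dy R Z (tsubst (\<lambda>y. if y = x then Some r else None) t2)"
      using Eq.prems(4) by (simp_all add: Cons_apos_of repl_var)
    ultimately have "dy R Z t1" "dy R Z t2" using whole Eq.prems(3) by blast+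
    then show ?case using Eq.prems(2) by auto
  next
    case (Pred P us)
    then obtain i where i: "i < length us" "t = us ! i" by (auto simp: in_set_conv_nth)
    show ?case
    proof (cases "t = Var x")
      case True
      then show ?thesis using var by simp
    next
      case False
      then show ?thesis using Pred.prems(4)[of t] i by (auto simp: apos_of_def intro!: bexI[of _ i])
    qed
  next
    case (InList s ns)
    show ?case
    proof (cases "t = Var x")
      case True
      then show ?thesis using var by simp
    next
      case False
      then show ?thesis using InList.prems by (auto simp: apos_of_def split: if_splits)
    qed
  next
    case (And \<alpha> \<beta>)
    have "apos_of pk x \<alpha> \<subseteq> aabs R X \<alpha>" "apos_of pk x \<beta> \<subseteq> aabs R X \<beta>"
      using part[OF And.prems(1), of 0] part[OF And.prems(1), of "Suc 0"]
      by (simp_all only: Cons_apos_of Cons_aabs)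
    then show ?case using And by (auto simp: Cons_apos_of)
  next
    case (Ex y \<alpha>)
    have "apos_of pk x \<alpha> \<subseteq> aabs R (insert (Var y) X) \<alpha>"
      using part[OF Ex.prems(1), of 0] by (simp only: Cons_apos_of Cons_aabs)
    moreover have "insert (Var y) X \<subseteq> Z" using Ex.prems(3) assms(4) by blast
    ultimately show ?case using Ex by (simp add: Cons_apos_of)
  next
    case (Says k \<alpha>)
    have "apos_of pk x \<alpha> \<subseteq> aabs R X \<alpha>"
      using part[OF Says.prems(1), of "Suc 0"] by (simp only: Cons_apos_of Cons_aabs)
    \<comment> \<open>The key of a says-assertion is never abstractable, so \<open>x\<close> does
      not stand there and the key survives the replacement.\<close>
    moreover have "[0, 0] \<notin> aabs R X (Says k \<alpha>)" by auto
    then have "[0, 0] \<notin> apos_of pk x (Says k \<alpha>)" using Says.prems(1) by blast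
    ultimately show ?case using Says by (auto simp: Cons_apos_of)
  qed
qed

text \<open>With all variables adjoined, the fresh variable of \<open>exE\<close> adds nothing and
  replacing the bound variable by it is a mere renaming. The side conditions of \<open>proj\<close>
  and \<open>exI\<close> do the remaining work.\<close>

lemma ded_terms:
  assumes "ded Vq pk R full S A \<alpha>" "vground S"
    and "\<And>\<delta> t. \<delta> \<in> A \<Longrightarrow> t \<in> aterms pk \<delta> \<Longrightarrow> dy R (with_vars S) t"
    and "t \<in> aterms pk \<alpha>"
  shows "dy R (with_vars S) t"
  using assms
proof (induction arbitrary: t rule: ded.induct)
  case (ax \<alpha> A \<beta> S)
  then obtain u h where "u \<in> aterms pk \<alpha>" "t = tsubst (\<lambda>x. map_option Var (h x)) u"
    using alpha_env_terms[of "[]" \<alpha> \<beta> t pk] by (auto simp: alpha_eq_def)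
  moreover have "dy R (with_vars S) u" using ax \<open>u \<in> aterms pk \<alpha>\<close> by simp
  ultimately show ?case using dy_rename[OF ax.prems(1)] by simp
next
  case (eq S t' A)
  then show ?case using dy_mono[of R S t' "with_vars S"] by auto
next
  case (cons S A ts us f)
  then have "dy R (with_vars S) t'" if "t' \<in> set ts \<union> set us" for t'
    using that by (auto simp: list_all2_conv_all_nth in_set_conv_nth)
  then show ?case using cons.prems(3) by (auto intro!: dy_con)
next
  case (trans ts S A)
  have ih: "dy R (with_vars S) (ts ! j) \<and> dy R (with_vars S) (ts ! Suc j)" if "Suc j < length ts" for j
    using trans that by auto
  obtain j where "length ts = Suc (Suc j)"
    using trans(1) by (metis Suc_le_D numeral_2_eq_2 Suc_le_mono)
  then have "dy R (with_vars S) (hd ts)" "dy R (with_vars S) (last ts)"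
    using ih[of 0] ih[of j] by (auto simp: hd_conv_nth last_conv_nth length_greater_0_conv[symmetric]
        simp del: length_greater_0_conv)
  then show ?case using trans.prems(3) by auto
next
  case (proj S A f ts us i)
  have "[i] \<in> tabs R S (Fn f ts)" "[i] \<in> tabs R S (Fn f us)" using proj by auto
  from this[THEN tabs_sub_at] have "dy R S (ts ! i)" "dy R S (us ! i)" by simp_all
  then show ?case using proj.prems(3) dy_mono[of R S _ "with_vars S"] by auto
next
  case (int ls S A t' ns)
  then obtain l where "l \<in> set ls" by (cases ls) auto
  then show ?case using int by auto
next
  case (wk S A t' a ns)
  then show ?case using dy_mono[of R S _ "with_vars S"] by auto
next
  case (exI x P \<alpha> S A s)
  show ?case
    by (rule arepl_terms_conv[of pk x \<alpha> R "insert (Var x) S" t "with_vars S" s]) (use exI in auto)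
next
  case (exE S A x \<alpha> P y \<gamma>)
  have wv: "with_vars (insert (Var y) S) = with_vars S" by auto
  have "dy R (with_vars S) u" if u: "u \<in> aterms pk (arepl \<alpha> P (Var y))" for u
  proof -
    obtain s where s: "s \<in> aterms pk \<alpha>" "u = s \<or> u = tsubst (\<lambda>z. if z = x then Some (Var y) else None) s"
      using arepl_terms[of u pk \<alpha> x "Var y"] u \<open>P = apos_of pk x \<alpha>\<close> by blast
    have 1: "dy R (with_vars S) s" using exE.IH(1) exE.prems s(1) by simp
    have eq: "(\<lambda>z. if z = x then Some (Var y) else None) =
        (\<lambda>z. map_option Var (if z = x then Some y else None))" by auto
    have "dy R (with_vars S) (tsubst (\<lambda>z. if z = x then Some (Var y) else None) s)"
      unfolding eq by (rule dy_rename[OF exE.prems(1) 1])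
    then show ?thesis using s(2) 1 by auto
  qed
  moreover have "vground (insert (Var y) S)" using exE by (auto simp: vground_def)
  ultimately show ?case using exE.IH(2)[of t] exE.prems unfolding wv by blast
next
  case (say S A \<alpha> k)
  have "dy R (with_vars S) k" using say.hyps by (auto intro: dy_mono)
  then have "dy R (with_vars S) (Fn pk [k])" by (auto intro!: dy_con)
  then show ?case using say.IH[OF say.prems(1,2)] say.prems(3) by auto
next
  case (sym S A t' u)
  show ?case using sym.IH[OF sym.prems(1,2)] sym.prems(3) by auto
next
  case (subst S A t' ns u)
  show ?case using subst.IH(1)[OF subst.prems(1,2)] subst.IH(2)[OF subst.prems(1,2)] subst.prems(3) by auto
next
  case (prom S A t' a)
  show ?case using prom.IH[OF prom.prems(1,2)] prom.prems(3) by auto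
next
  case (andI S A \<alpha> \<beta>)
  show ?case using andI.IH(1)[OF andI.prems(1,2)] andI.IH(2)[OF andI.prems(1,2)] andI.prems(3) by auto
next
  case (andE1 S A \<alpha> \<beta>)
  show ?case using andE1.IH[OF andE1.prems(1,2)] andE1.prems(3) by auto
next
  case (andE2 S A \<alpha> \<beta>)
  show ?case using andE2.IH[OF andE2.prems(1,2)] andE2.prems(3) by auto
qed

section \<open>Order of events\<close>

text \<open>The condition is monotone in the set \<open>V\<close> of variables received so far,
  which is why it survives interleaving although other sessions add to \<open>V\<close>.\<close>

fun causal :: "'v set \<Rightarrow> ('f, 'n, 'v, 'p) event list \<Rightarrow> bool" where
  "causal V [] \<longleftrightarrow> True"
| "causal V ((a, \<beta>, \<alpha>) # es) \<longleftrightarrow> fv \<alpha> \<subseteq> V \<union> fv \<beta> \<and> causal (V \<union> fv \<beta>) es"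

lemma causal_mono: "causal V es \<Longrightarrow> V \<subseteq> W \<Longrightarrow> causal W es"
proof (induction es arbitrary: V W)
  case (Cons e es)
  obtain a \<beta> \<alpha> where e: "e = (a, \<beta>, \<alpha>)" by (cases e)
  then have "causal (W \<union> fv \<beta>) es"
    using Cons.IH[of "V \<union> fv \<beta>" "W \<union> fv \<beta>"] Cons.prems by (simp add: le_supI1)
  then show ?case using Cons.prems e by auto
qed simp

lemma causal_shuffles: "es \<in> shuffles s s' \<Longrightarrow> causal V s \<Longrightarrow> causal V s' \<Longrightarrow> causal V es"
proof (induction s s' arbitrary: V es rule: shuffles.induct)
  case (3 e s e' s')
  obtain a \<beta> \<alpha> where e: "e = (a, \<beta>, \<alpha>)" by (cases e)
  obtain a' \<beta>' \<alpha>' where e': "e' = (a', \<beta>', \<alpha>')" by (cases e')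
  from 3(3) consider es' where "es = e # es'" "es' \<in> shuffles s (e' # s')"
    | es' where "es = e' # es'" "es' \<in> shuffles (e # s) s'"
    by auto
  then show ?case
  proof cases
    case 1
    then show ?thesis using 3(1)[OF 1(2), of "V \<union> fv \<beta>"] 3(4,5) causal_mono[of V "e' # s'" "V \<union> fv \<beta>"]
      by (auto simp: e)
  next
    case 2
    then show ?thesis using 3(2)[OF 2(2), of "V \<union> fv \<beta>'"] 3(4,5) causal_mono[of V "e # s" "V \<union> fv \<beta>'"]
      by (auto simp: e')
  qed
qed auto

lemma causal_interleavings:
  "es \<in> interleavings ss \<Longrightarrow> (\<And>s. s \<in> set ss \<Longrightarrow> causal V s) \<Longrightarrow> causal V es"
  by (induction ss arbitrary: es) (auto intro: causal_shuffles)

lemma set_interleavings: "es \<in> interleavings ss \<Longrightarrow> set es = (\<Union>s\<in>set ss. set s)"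
  by (induction ss arbitrary: es) (auto simp: set_shuffles)

lemma causal_iff:
  "causal V es \<longleftrightarrow> (\<forall>i<length es. fv (snd (snd (es ! i))) \<subseteq> V \<union> (\<Union>k\<le>i. fv (fst (snd (es ! k)))))"
proof (induction V es rule: causal.induct)
  case (2 V a \<beta> \<alpha> es)
  have "(\<Union>k\<le>Suc i. fv (fst (snd (((a, \<beta>, \<alpha>) # es) ! k)))) = fv \<beta> \<union> (\<Union>k\<le>i. fv (fst (snd (es ! k))))" for i
    by (simp add: atMost_Suc_eq_insert_0)
  then show ?case using 2 by (simp add: All_less_Suc2 Un_assoc)
qed simp

text \<open>A sent variable not received up to its step is an agent variable, and a session replaces
  those by names.\<close>

lemma session_causal:
  fixes s :: "('f, 'n, 'v, 'p) event list"
  assumes "is_session Ag Pr s"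
  shows "causal {} s"
proof -
  obtain a \<eta> len \<rho> where s: "len \<le> length \<eta>"
    "s = map (\<lambda>(\<beta>, \<alpha>). (a, asubst (\<lambda>x. if x \<in> agent_vars \<eta> then Some (Nm (\<rho> x)) else None) \<beta>,
      asubst (\<lambda>x. if x \<in> agent_vars \<eta> then Some (Nm (\<rho> x)) else None) \<alpha>)) (take len \<eta>)"
    using assms unfolding is_session_def Let_def by blast
  define inst :: "('f, 'n, 'v) subst" where "inst = (\<lambda>x. if x \<in> agent_vars \<eta> then Some (Nm (\<rho> x)) else None)"
  have "dom inst = agent_vars \<eta>" "\<And>t. t \<in> ran inst \<Longrightarrow> vars t = {}"
    by (auto simp: inst_def ran_def dom_def split: if_splits)
  then have fv: "fv (asubst inst \<gamma>) = fv \<gamma> - agent_vars \<eta>" for \<gamma> :: "('f, 'n, 'v, 'p) assn"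
    by (simp add: fv_asubst_ground)
  have nth: "fst (snd (s ! i)) = asubst inst (fst (\<eta> ! i))" "snd (snd (s ! i)) = asubst inst (snd (\<eta> ! i))"
    if "i < len" for i
    using that s by (auto simp: inst_def split: prod.splits)
  have len: "length s = len" using s by simp
  show ?thesis unfolding causal_iff
  proof (intro allI impI subsetI)
    fix i x assume i: "i < length s" and x: "x \<in> fv (snd (snd (s ! i)))"
    then have "x \<in> fv (snd (\<eta> ! i))" "x \<notin> agent_vars \<eta>" by (auto simp: nth fv len)
    moreover have "i < length \<eta>" using i len s(1) by simp
    ultimately obtain l where l: "l \<le> i" "x \<in> fv (fst (\<eta> ! l))" by (auto simp: agent_vars_def)
    then have "x \<in> fv (fst (snd (s ! l)))" using i \<open>x \<notin> agent_vars \<eta>\<close> by (simp add: nth fv len)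
    then show "x \<in> {} \<union> (\<Union>k\<le>i. fv (fst (snd (s ! k))))" using l by auto
  qed
qed

lemma session_event:
  fixes s :: "('f, 'n, 'v, 'p) event list"
  assumes "is_protocol Vq Pr" "is_session Ag Pr s" "(a, \<beta>, \<alpha>) \<in> set s"
  shows "a \<in> Ag \<and> bv \<beta> \<subseteq> Vq \<and> bv \<alpha> \<subseteq> Vq"
proof -
  obtain a' \<eta> len inst where s: "a' \<in> Ag" "\<eta> \<in> Pr"
    "s = map (\<lambda>(\<beta>, \<alpha>). (a', asubst inst \<beta>, asubst inst \<alpha>)) (take len \<eta>)"
    using assms(2) unfolding is_session_def Let_def by blast
  obtain \<beta>' \<alpha>' where "(\<beta>', \<alpha>') \<in> set \<eta>" "a = a'" "\<beta> = asubst inst \<beta>'" "\<alpha> = asubst inst \<alpha>'"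
    using assms(3) unfolding s(3) by (auto dest: in_set_takeD)
  moreover have "bv (asubst l \<gamma>) = bv \<gamma>" for l and \<gamma> :: "('f, 'n, 'v, 'p) assn"
    by (metis bvs_asubst set_bvs)
  moreover have "wf_assn Vq \<beta>' \<and> wf_assn Vq \<alpha>'"
    using assms(1) s(2) calculation(1) unfolding is_protocol_def by blast
  moreover from this have "bv \<beta>' \<subseteq> Vq" "bv \<alpha>' \<subseteq> Vq" by (simp_all add: wf_assn_bv)
  ultimately show ?thesis using s(1) by simp
qed

lemma distinct_concat_nth:
  "distinct (concat xss) \<Longrightarrow> i < j \<Longrightarrow> j < length xss \<Longrightarrow> set (xss ! i) \<inter> set (xss ! j) = {}"
proof (induction xss arbitrary: i j)
  case (Cons xs xss)
  obtain j' where j: "j = Suc j'" using Cons.prems(2) by (cases j) auto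
  show ?case
  proof (cases i)
    case 0
    moreover have "xss ! j' \<in> set xss" using Cons.prems(3) j by simp
    then have "set (xss ! j') \<subseteq> set (concat xss)" by auto
    ultimately show ?thesis using Cons.prems(1) j by auto
  next
    case (Suc i')
    then show ?thesis using Cons j by simp
  qed
qed simp

section \<open>Sequences of substitutions\<close>

abbreviation applies :: "('f, 'n, 'v) subst list \<Rightarrow> ('f, 'n, 'v) trm \<Rightarrow> ('f, 'n, 'v) trm" where
  "applies ls t \<equiv> foldr tsubst ls t"

lemma tsubst_foldl_scomp: "tsubst (foldl scomp l ls) t = tsubst l (applies ls t)"
  by (induction ls arbitrary: l) (auto simp: tsubst_scomp)

lemma applies_disjoint: "(\<And>k. k \<in> set ls \<Longrightarrow> vars t \<inter> dom k = {}) \<Longrightarrow> applies ls t = t"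
  by (induction ls) (auto simp: tsubst_disjoint)

lemma tsubst_absorb:
  assumes "\<And>x. tsubst w (tsubst k (Var x)) = tsubst w (Var x)"
  shows "tsubst w (tsubst k t) = tsubst w t"
  using assms by (induction t) auto

text \<open>In the composite, \<open>bs\<close> acts before \<open>k\<close>. If it touches neither
  the domain nor the range of \<open>k\<close>, and \<open>k\<close> does not touch its own range,
  then \<open>x\<close> and \<open>k x\<close> have the same value after \<open>k\<close>.\<close>

lemma applies_absorb:
  assumes "\<And>k'. k' \<in> set (k # bs) \<Longrightarrow> (\<Union>s\<in>ran k. vars s) \<inter> dom k' = {}"
    and "\<And>k'. k' \<in> set bs \<Longrightarrow> dom k \<inter> dom k' = {}"
  shows "tsubst (foldl scomp l (as @ k # bs)) (tsubst k t) = tsubst (foldl scomp l (as @ k # bs)) t"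
proof -
  have "tsubst (foldl scomp l (as @ k # bs)) (tsubst k (Var x)) = tsubst (foldl scomp l (as @ k # bs)) (Var x)" for x
  proof (cases "k x")
    case (Some s)
    then have "s \<in> ran k" "x \<in> dom k" by (auto simp: ran_def)
    then have bs: "applies bs (Var x) = Var x" "applies (k # bs) s = s"
      using assms by (intro applies_disjoint; fastforce)+
    have eq: "tsubst (foldl scomp l (as @ k # bs)) u = tsubst l (applies as (applies (k # bs) u))" for u
      by (simp only: tsubst_foldl_scomp foldr_append)
    have "tsubst k (Var x) = s" using Some by simp
    moreover have "applies (k # bs) (Var x) = s" using bs(1) calculation by simp
    ultimately show ?thesis by (simp only: eq bs(2))
  qed simp
  then show ?thesis by (rule tsubst_absorb)
qed

lemma disjoint_mono: "A \<subseteq> X \<Longrightarrow> C \<subseteq> Y \<Longrightarrow> X \<inter> Y = {} \<Longrightarrow> A \<inter> C = {}"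
  by blast

section \<open>Runs\<close>

locale run_setting =
  fixes Vq :: "'v set" and pk :: 'f and R :: "'f drule set"
    and Pr :: "('f, 'n, 'v, 'p) role set" and r :: "('f, 'n, 'v, 'p) run"
  assumes norm: "normalization TYPE(('f, 'n, 'v) trm) R"
    and subt: "subterm_property TYPE(('f, 'n, 'v) trm) R"
    and prot: "is_protocol Vq Pr"
    and run: "is_run Vq pk R Pr r"
    and wit: "run_witnesses Vq pk R r"
    and spare: "spare_name pk r"
begin

abbreviation "N \<equiv> length (events r)"
abbreviation "fvs \<equiv> fv_events (events r)"
abbreviation "\<sigma> \<equiv> sg r"
abbreviation "\<omega> \<equiv> om r"
abbreviation "T i \<equiv> fst (TE r i)"
abbreviation "E i \<equiv> snd (TE r i)"
abbreviation "B i \<equiv> bv (rcv r i)"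
abbreviation "G i \<equiv> bv (snt r i)"

lemma event_in: "1 \<le> i \<Longrightarrow> i \<le> N \<Longrightarrow> (actor r i, rcv r i, snt r i) \<in> set (events r)"
  by (auto simp: actor_def rcv_def snt_def)

lemma event_props:
  assumes "1 \<le> i" "i \<le> N"
  shows "actor r i \<in> agents r" "B i \<subseteq> Vq" "G i \<subseteq> Vq" "fv (rcv r i) \<subseteq> fvs" "fv (snt r i) \<subseteq> fvs"
    "fvs \<inter> B i = {}" "fvs \<inter> G i = {}"
proof -
  obtain ss where ss: "\<forall>s\<in>set ss. is_session (agents r) Pr s" "events r \<in> interleavings ss"
    using run unfolding is_run_def by blast
  then obtain s where "s \<in> set ss" "(actor r i, rcv r i, snt r i) \<in> set s"
    using event_in[OF assms] set_interleavings by blast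
  then show "actor r i \<in> agents r" "B i \<subseteq> Vq" "G i \<subseteq> Vq" using session_event[OF prot] ss(1) by blast+
  show fv: "fv (rcv r i) \<subseteq> fvs" "fv (snt r i) \<subseteq> fvs"
    using event_in[OF assms] unfolding fv_events_def by blast+
  have "fvs \<inter> Vq = {}" using run by (simp add: is_run_def)
  then show "fvs \<inter> B i = {}" "fvs \<inter> G i = {}" using \<open>B i \<subseteq> Vq\<close> \<open>G i \<subseteq> Vq\<close> by auto
qed

lemma fvs_Vq: "fvs \<inter> Vq = {}"
  using run by (simp add: is_run_def)

lemma dom_sigma: "dom \<sigma> = fvs"
  using run by (simp add: is_run_def)

lemma ran_sigma: "t \<in> ran \<sigma> \<Longrightarrow> vars t = {}"
  using run by (simp add: is_run_def)

lemma sigma_var: "x \<in> fvs \<Longrightarrow> \<exists>t. \<sigma> x = Some t \<and> vars t = {}"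
  using dom_sigma ran_sigma by (metis domD ranI)

lemma vars_sigma: "vars (tsubst \<sigma> t) = vars t - fvs"
  using ran_sigma dom_sigma by (induction t) (auto simp: ran_def domIff split: option.splits)

lemma bound_disjoint:
  assumes "1 \<le> i" "i \<le> N"
  shows "B i \<inter> G i = {}" "i < j \<Longrightarrow> j \<le> N \<Longrightarrow> (B i \<union> G i) \<inter> (B j \<union> G j) = {}"
proof -
  define xss where "xss = map (\<lambda>(a, \<beta>, \<alpha>). bvs \<beta> @ bvs \<alpha>) (events r)"
  have d: "distinct (concat xss)" using run by (simp add: is_run_def bvs_events_def xss_def)
  have nth: "xss ! (i - 1) = bvs (rcv r i) @ bvs (snt r i)" if "1 \<le> i" "i \<le> N" for i
    using that by (auto simp: xss_def rcv_def snt_def split: prod.splits)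
  have "distinct (xss ! (i - 1))" using d assms by (auto simp: distinct_concat_iff xss_def)
  then show "B i \<inter> G i = {}" unfolding nth[OF assms] by simp
  assume j: "i < j" "j \<le> N"
  show "(B i \<union> G i) \<inter> (B j \<union> G j) = {}"
  proof -
    have "set (xss ! (i - 1)) \<inter> set (xss ! (j - 1)) = {}"
      by (rule distinct_concat_nth[OF d]) (use j assms in \<open>auto simp: xss_def\<close>)
    then show ?thesis using nth[of i] nth[of j] j assms by simp
  qed
qed

lemma causal_run:
  assumes "1 \<le> j" "j \<le> N" "x \<in> fv (snt r j)"
  shows "\<exists>k. 1 \<le> k \<and> k \<le> j \<and> x \<in> fv (rcv r k)"
proof -
  have "causal {} (events r)"
  proof -
    obtain ss where "\<forall>s\<in>set ss. is_session (agents r) Pr s" "events r \<in> interleavings ss"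
      using run unfolding is_run_def by blast
    then show ?thesis using causal_interleavings[of "events r" ss "{}"] session_causal by blast
  qed
  moreover have "j - 1 < length (events r)" using assms by auto
  ultimately have "x \<in> (\<Union>k\<le>j - 1. fv (fst (snd (events r ! k))))"
    using assms unfolding causal_iff snt_def by fastforce
  then obtain k where "k \<le> j - 1" "x \<in> fv (fst (snd (events r ! k)))" by auto
  then show ?thesis using assms by (intro HOL.exI[of _ "Suc k"]) (auto simp: rcv_def)
qed

lemma know_step:
  assumes "1 \<le> i" "i \<le> N"
  shows "know r i (actor r i) = update Vq pk (know r (i - 1) (actor r i)) (rcv r i)"
    "know r i (intruder r) = update Vq pk (know r (i - 1) (intruder r)) (snt r i)"
    "a \<in> agents r \<Longrightarrow> a \<noteq> actor r i \<Longrightarrow> a \<noteq> intruder r \<Longrightarrow> know r i a = know r (i - 1) a"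
    "ded_a Vq pk R (ksubst \<sigma> (know r (i - 1) (intruder r))) (asubst \<sigma> (rcv r i))"
proof -
  have "\<forall>i\<in>{1..N}. (\<forall>a\<in>agents r - {actor r i, intruder r}. know r i a = know r (i - 1) a) \<and>
      know r i (actor r i) = update Vq pk (know r (i - 1) (actor r i)) (rcv r i) \<and>
      know r i (intruder r) = update Vq pk (know r (i - 1) (intruder r)) (snt r i) \<and>
      ded_a Vq pk R (know r i (actor r i)) (snt r i) \<and>
      ded_a Vq pk R (ksubst \<sigma> (know r (i - 1) (intruder r))) (asubst \<sigma> (rcv r i))"
    using run unfolding is_run_def by (elim conjE)
  from bspec[OF this, of i] assms
  show "know r i (actor r i) = update Vq pk (know r (i - 1) (actor r i)) (rcv r i)"
    "know r i (intruder r) = update Vq pk (know r (i - 1) (intruder r)) (snt r i)"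
    "a \<in> agents r \<Longrightarrow> a \<noteq> actor r i \<Longrightarrow> a \<noteq> intruder r \<Longrightarrow> know r i a = know r (i - 1) a"
    "ded_a Vq pk R (ksubst \<sigma> (know r (i - 1) (intruder r))) (asubst \<sigma> (rcv r i))"
    by simp_all
qed

lemma intruder_agent: "intruder r \<in> agents r"
  using run by (simp add: is_run_def)

lemma know_0: "a \<in> agents r \<Longrightarrow> know r 0 a = (init r a, {})"
  using run by (simp add: is_run_def)

lemma init_ground: "a \<in> agents r \<Longrightarrow> t \<in> init r a \<Longrightarrow> vars t = {}"
  using run unfolding is_run_def by blast

lemma know_intruder:
  "i \<le> N \<Longrightarrow> know r i (intruder r) =
     (init r (intruder r) \<union> (\<Union>j\<in>{1..i}. pubs Vq pk (snt r j)), snt r ` {1..i})"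
proof (induction i)
  case 0
  then show ?case using know_0 intruder_agent by simp
next
  case (Suc i)
  then show ?case using know_step(2)[of "Suc i"]
    by (auto simp: update_def atLeastAtMostSuc_conv)
qed

lemma T_eq: "i \<le> N \<Longrightarrow> T i = init r (intruder r) \<union> (\<Union>j\<in>{1..i}. pubs Vq pk (snt r j)) \<union> Var ` (\<Union>j\<in>{1..i}. G j)"
  by (simp add: TE_def ker_def know_intruder)

lemma E_eq: "i \<le> N \<Longrightarrow> E i = (\<Union>j\<in>{1..i}. at (snt r j))"
  by (simp add: TE_def ker_def know_intruder)

lemma T_mono: "k \<le> i \<Longrightarrow> i \<le> N \<Longrightarrow> T k \<subseteq> T i"
proof -
  assume "k \<le> i" "i \<le> N"
  moreover from this have "{1..k} \<subseteq> {1..i}" by simp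
  ultimately show ?thesis by (simp only: T_eq order_trans[of k i N]) blast
qed

lemma spare_T: "i \<le> N \<Longrightarrow> Nm (spare r) \<in> T i"
  using spare T_mono[of 0 i] by (auto simp: spare_name_def)

section \<open>Variables available at each stage of the run\<close>

definition kvars :: "nat \<Rightarrow> 'n \<Rightarrow> 'v set" where
  "kvars i a = (\<Union>t\<in>fst (know r i a). vars t) \<union> (\<Union>\<delta>\<in>snd (know r i a). bv \<delta>)"

lemma vars_pubs:
  assumes "t \<in> pubs Vq pk \<alpha>"
  shows "vars t \<subseteq> (fv \<alpha> \<union> bv \<alpha>) - Vq"
proof -
  obtain u where "u \<in> aterms pk \<alpha>" "t \<in> tpubs Vq u" using st_pubs[OF assms] by blast
  then show ?thesis using vars_tpubs[of t Vq u] vars_aterms[of u pk \<alpha>] by blast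
qed

lemma vars_pubs_snt: "1 \<le> j \<Longrightarrow> j \<le> N \<Longrightarrow> t \<in> pubs Vq pk (snt r j) \<Longrightarrow> vars t \<subseteq> fv (snt r j)"
  using vars_pubs[of t "snt r j"] event_props(3)[of j] by blast

lemma kvars_update:
  assumes "know r i a = update Vq pk (know r j a) \<gamma>" "fv \<gamma> \<subseteq> fvs"
  shows "kvars i a \<subseteq> kvars j a \<union> fvs \<union> bv \<gamma>"
  using assms vars_pubs unfolding kvars_def by (fastforce simp: update_def)

lemma kvars_step:
  assumes "1 \<le> i" "i \<le> N" "a \<in> agents r"
  shows "kvars i a \<subseteq> kvars (i - 1) a \<union> fvs \<union> (if a = actor r i then B i else G i)"
proof -
  consider "a = actor r i" | "a \<noteq> actor r i" "a = intruder r" | "a \<noteq> actor r i" "a \<noteq> intruder r" by blast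
  then show ?thesis
  proof cases
    case 1
    then show ?thesis using kvars_update know_step(1)[OF assms(1,2)] event_props(4)[OF assms(1,2)] by simp
  next
    case 2
    then show ?thesis using kvars_update know_step(2)[OF assms(1,2)] event_props(5)[OF assms(1,2)] by simp
  next
    case 3
    then show ?thesis using know_step(3)[OF assms(1,2,3)] by (auto simp: kvars_def)
  qed
qed

lemma kvars_bound:
  "i \<le> N \<Longrightarrow> a \<in> agents r \<Longrightarrow> kvars i a \<subseteq> fvs \<union> (\<Union>j\<in>{1..i}. B j \<union> G j)"
proof (induction i)
  case 0
  then show ?case using know_0 init_ground by (auto simp: kvars_def)
next
  case (Suc i)
  then have "kvars (Suc i) a \<subseteq> kvars i a \<union> fvs \<union> (B (Suc i) \<union> G (Suc i))"
    using kvars_step[of "Suc i" a] by (auto split: if_splits)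
  then show ?case using Suc by (fastforce simp: atLeastAtMostSuc_conv)
qed

lemma vars_ker: "(\<Union>t\<in>fst (ker (know r i a)). vars t) = kvars i a"
  by (auto simp: ker_def kvars_def)

lemma witness_facts:
  assumes "1 \<le> i" "i \<le> N"
  shows "witnesses Vq pk R \<sigma> (TE r (i - 1)) (rcv r i) (XX r i) (mu r i)"
    "witnesses Vq pk R \<sigma> (UF r i) (snt r i) (YY r i) (theta r i)"
  using wit assms by (auto simp: run_witnesses_def)

text \<open>A derivable term has no variables beyond those of the axioms, and the ground
  substitution \<open>\<sigma>\<close> has removed the free variables of the run from these.\<close>

lemma vars_witness:
  assumes "witnesses Vq pk R \<sigma> (ker (know r j a)) \<gamma> X m"
  shows "(\<Union>s\<in>ran m. vars s) \<subseteq> kvars j a - fvs" "dom m \<subseteq> bv \<gamma>"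
proof -
  show "dom m \<subseteq> bv \<gamma>" using assms by (auto simp: witnesses_def)
  show "(\<Union>s\<in>ran m. vars s) \<subseteq> kvars j a - fvs"
  proof
    fix x assume "x \<in> (\<Union>s\<in>ran m. vars s)"
    then obtain s where "s \<in> ran m" "x \<in> vars s" by auto
    then have "x \<in> (\<Union>t\<in>fst (ker (know r j a)). vars (tsubst \<sigma> t))"
      using assms dy_vars unfolding witnesses_def by fastforce
    then show "x \<in> kvars j a - fvs" using vars_ker by (auto simp: vars_sigma)
  qed
qed

lemma mu_vars:
  assumes "1 \<le> i" "i \<le> N"
  shows "(\<Union>s\<in>ran (mu r i). vars s) \<subseteq> (\<Union>j\<in>{1..<i}. B j \<union> G j)" "dom (mu r i) \<subseteq> B i"
proof -
  have w: "witnesses Vq pk R \<sigma> (ker (know r (i - 1) (intruder r))) (rcv r i) (XX r i) (mu r i)"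
    using witness_facts(1)[OF assms] by (simp add: TE_def)
  have "{1..i - 1} = {1..<i}" using assms by auto
  then show "(\<Union>s\<in>ran (mu r i). vars s) \<subseteq> (\<Union>j\<in>{1..<i}. B j \<union> G j)"
  proof -
    have "kvars (i - 1) (intruder r) \<subseteq> fvs \<union> (\<Union>j\<in>{1..<i}. B j \<union> G j)"
      using kvars_bound[of "i - 1" "intruder r"] intruder_agent assms \<open>{1..i - 1} = {1..<i}\<close> by simp
    then show ?thesis using vars_witness(1)[OF w] by blast
  qed
  show "dom (mu r i) \<subseteq> B i" by (rule vars_witness(2)[OF w])
qed

lemma theta_vars:
  assumes "1 \<le> i" "i \<le> N"
  shows "(\<Union>s\<in>ran (theta r i). vars s) \<subseteq> (\<Union>j\<in>{1..<i}. B j \<union> G j) \<union> B i" "dom (theta r i) \<subseteq> G i"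
proof -
  have w: "witnesses Vq pk R \<sigma> (ker (know r i (actor r i))) (snt r i) (YY r i) (theta r i)"
    using witness_facts(2)[OF assms] by (simp add: UF_def)
  have "{1..i - 1} = {1..<i}" using assms by auto
  then show "(\<Union>s\<in>ran (theta r i). vars s) \<subseteq> (\<Union>j\<in>{1..<i}. B j \<union> G j) \<union> B i"
  proof -
    have "kvars i (actor r i) \<subseteq> kvars (i - 1) (actor r i) \<union> fvs \<union> B i"
      using kvars_step[OF assms, of "actor r i"] event_props(1)[OF assms] by simp
    moreover have "kvars (i - 1) (actor r i) \<subseteq> fvs \<union> (\<Union>j\<in>{1..<i}. B j \<union> G j)"
      using kvars_bound[of "i - 1" "actor r i"] event_props(1)[OF assms] assms \<open>{1..i - 1} = {1..<i}\<close> by simp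
    ultimately show ?thesis using vars_witness(1)[OF w] by blast
  qed
  show "dom (theta r i) \<subseteq> G i" by (rule vars_witness(2)[OF w])
qed

section \<open>Absorption of the substitutions by \<open>\<omega>\<close>\<close>

lemma omega_split:
  assumes "1 \<le> i" "i \<le> N"
  defines "as \<equiv> concat (map (\<lambda>i. [mu r i, theta r i]) [1..<i])"
    and "bs \<equiv> concat (map (\<lambda>i. [mu r i, theta r i]) [Suc i..<N + 1])"
  shows "\<omega> = foldl scomp \<sigma> (as @ mu r i # theta r i # bs)"
    "\<omega> = foldl scomp \<sigma> ((as @ [mu r i]) @ theta r i # bs)"
proof -
  have "[1..<N + 1] = [1..<i] @ [i..<N + 1]" using assms by (metis le_add1 le_Suc_ex upt_add_eq_append le_SucI Suc_eq_plus1)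
  also have "[i..<N + 1] = i # [Suc i..<N + 1]" using assms by (simp add: upt_conv_Cons)
  finally show "\<omega> = foldl scomp \<sigma> (as @ mu r i # theta r i # bs)" by (simp add: om_def as_def bs_def)
  then show "\<omega> = foldl scomp \<sigma> ((as @ [mu r i]) @ theta r i # bs)" by simp
qed

lemma later_dom:
  assumes "1 \<le> i" "i \<le> N" "k \<in> set (concat (map (\<lambda>i. [mu r i, theta r i]) [Suc i..<N + 1]))"
  shows "((\<Union>j\<in>{1..<i}. B j \<union> G j) \<union> B i \<union> G i) \<inter> dom k = {}"
proof -
  from assms(3) obtain l where "l \<in> set [Suc i..<N + 1]" "k = mu r l \<or> k = theta r l"
    by (auto simp del: upt_Suc set_upt)
  then have l: "i < l" "l \<le> N" "k = mu r l \<or> k = theta r l" by auto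
  then have "dom k \<subseteq> B l \<union> G l" using mu_vars(2)[of l] theta_vars(2)[of l] assms by auto
  moreover have "(B j \<union> G j) \<inter> (B l \<union> G l) = {}" if "1 \<le> j" "j \<le> i" for j
    using bound_disjoint(2)[of j l] that l by auto
  ultimately show ?thesis using assms(1) by fastforce
qed

lemma earlier_disjoint:
  assumes "1 \<le> i" "i \<le> N"
  shows "(\<Union>j\<in>{1..<i}. B j \<union> G j) \<inter> (B i \<union> G i) = {}"
proof -
  have "(B j \<union> G j) \<inter> (B i \<union> G i) = {}" if "j \<in> {1..<i}" for j
    using bound_disjoint(2)[of j i] that assms by simp
  then show ?thesis by blast
qed

lemma omega_mu:
  assumes "1 \<le> i" "i \<le> N"
  shows "tsubst \<omega> (tsubst (mu r i) t) = tsubst \<omega> t"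
  unfolding omega_split(1)[OF assms]
proof (rule applies_absorb)
  let ?bs = "concat (map (\<lambda>i. [mu r i, theta r i]) [Suc i..<N + 1])"
  fix k assume "k \<in> set (mu r i # theta r i # ?bs)"
  then consider "k = mu r i" | "k = theta r i" | "k \<in> set ?bs" unfolding list.set(2) insert_iff by blast
  then show "(\<Union>s\<in>ran (mu r i). vars s) \<inter> dom k = {}"
  proof cases
    case 1
    then show ?thesis
      using disjoint_mono[OF mu_vars(1) le_supI1[OF mu_vars(2)] earlier_disjoint] assms by simp
  next
    case 2
    then show ?thesis
      using disjoint_mono[OF mu_vars(1) le_supI2[OF theta_vars(2)] earlier_disjoint] assms by simp
  next
    case 3
    then show ?thesis
      using disjoint_mono[OF le_supI1[OF le_supI1[OF mu_vars(1)]] order_refl later_dom] assms by simp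
  qed
next
  let ?bs = "concat (map (\<lambda>i. [mu r i, theta r i]) [Suc i..<N + 1])"
  fix k assume "k \<in> set (theta r i # ?bs)"
  then consider "k = theta r i" | "k \<in> set ?bs" unfolding list.set(2) insert_iff by blast
  then show "dom (mu r i) \<inter> dom k = {}"
  proof cases
    case 1
    then show ?thesis using disjoint_mono[OF mu_vars(2) theta_vars(2) bound_disjoint(1)] assms by simp
  next
    case 2
    then show ?thesis
      using disjoint_mono[OF le_supI1[OF le_supI2[OF mu_vars(2)]] order_refl later_dom] assms by simp
  qed
qed

lemma omega_theta:
  assumes "1 \<le> i" "i \<le> N"
  shows "tsubst \<omega> (tsubst (theta r i) t) = tsubst \<omega> t"
  unfolding omega_split(2)[OF assms]
proof (rule applies_absorb)
  let ?bs = "concat (map (\<lambda>i. [mu r i, theta r i]) [Suc i..<N + 1])"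
  fix k assume "k \<in> set (theta r i # ?bs)"
  then consider "k = theta r i" | "k \<in> set ?bs" unfolding list.set(2) insert_iff by blast
  then show "(\<Union>s\<in>ran (theta r i). vars s) \<inter> dom k = {}"
  proof cases
    case 1
    have "((\<Union>j\<in>{1..<i}. B j \<union> G j) \<union> B i) \<inter> G i = {}"
      using earlier_disjoint[OF assms] bound_disjoint(1)[OF assms] by (simp add: Int_Un_distrib Int_Un_distrib2)
    from disjoint_mono[OF theta_vars(1,2) this] show ?thesis using assms 1 by simp
  next
    case 2
    then show ?thesis
      using disjoint_mono[OF le_supI1[OF theta_vars(1)] order_refl later_dom] assms by simp
  qed
next
  let ?bs = "concat (map (\<lambda>i. [mu r i, theta r i]) [Suc i..<N + 1])"
  fix k assume "k \<in> set ?bs"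
  then show "dom (theta r i) \<inter> dom k = {}"
    using disjoint_mono[OF le_supI2[OF theta_vars(2)] order_refl later_dom] assms by simp
qed

text \<open>No \<open>mu\<close> or \<open>theta\<close> acts on a free variable of the run, so
  there \<open>\<omega>\<close> agrees with \<open>\<sigma>\<close>, whose values are
  ground.\<close>

lemma omega_sigma: "tsubst \<omega> (tsubst \<sigma> t) = tsubst \<omega> t"
proof -
  have "tsubst \<omega> (tsubst \<sigma> (Var x)) = tsubst \<omega> (Var x)" for x
  proof (cases "x \<in> fvs")
    case True
    then obtain s where s: "\<sigma> x = Some s" "vars s = {}" using sigma_var by blast
    have "applies (concat (map (\<lambda>i. [mu r i, theta r i]) [1..<N + 1])) (Var x) = Var x"
    proof (rule applies_disjoint)
      fix k assume "k \<in> set (concat (map (\<lambda>i. [mu r i, theta r i]) [1..<N + 1]))"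
      then obtain l where "l \<in> set [1..<N + 1]" "k = mu r l \<or> k = theta r l"
        by (auto simp del: upt_Suc set_upt)
      then have l: "1 \<le> l" "l \<le> N" "k = mu r l \<or> k = theta r l" by auto
      then have "dom k \<subseteq> B l \<union> G l" using mu_vars(2)[of l] theta_vars(2)[of l] by auto
      then show "vars (Var x) \<inter> dom k = {}" using True event_props(6,7)[OF l(1,2)] by auto
    qed
    then have "tsubst \<omega> (Var x) = tsubst \<sigma> (Var x)" by (simp only: om_def tsubst_foldl_scomp)
    then show ?thesis using s by (simp add: tsubst_ground)
  next
    case False
    then have "\<sigma> x = None" using dom_sigma by auto
    then show ?thesis by simp
  qed
  then show ?thesis by (rule tsubst_absorb)
qed

section \<open>Knowledge of the intruder\<close>

abbreviation "S i \<equiv> tsubst \<sigma> ` T i"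

lemma dom_sigma_bv: "1 \<le> i \<Longrightarrow> i \<le> N \<Longrightarrow> bv (snt r i) \<inter> dom \<sigma> = {}"
  using event_props(7)[of i] dom_sigma by auto

text \<open>The set \<open>X\<close> is left open because the lemma serves both the kernel, which
  contains the binders, and the plain knowledge extended by all variables.\<close>

lemma sent_term_derivable:
  assumes "1 \<le> j" "j \<le> N" "t \<in> aterms pk (snt r j)"
    and "tsubst \<sigma> ` pubs Vq pk (snt r j) \<subseteq> X" "Var ` G j \<subseteq> X"
  shows "dy R X (tsubst \<sigma> t)"
proof (rule dy_from_pubs)
  fix s assume "s \<in> tpubs Vq t"
  then have "s \<in> pubs Vq pk (snt r j)" using assms(3) by (auto simp: pubs_def)
  then show "dy R X (tsubst \<sigma> s)" using assms(4) by (auto intro: dy_ax)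
next
  fix x assume x: "x \<in> vars t" "x \<in> Vq"
  then have "x \<notin> fvs" using fvs_Vq by blast
  then have "x \<in> G j" using x vars_aterms[OF assms(3)] event_props(5)[OF assms(1,2)] by blast
  moreover have "\<sigma> x = None" using \<open>x \<notin> fvs\<close> dom_sigma by blast
  ultimately show "dy R X (tsubst \<sigma> (Var x))" using assms(5) by (auto intro: dy_ax)
qed

lemma T_sent:
  assumes "1 \<le> j" "j \<le> i" "i \<le> N"
  shows "pubs Vq pk (snt r j) \<subseteq> T i" "Var ` G j \<subseteq> T i"
proof -
  have "j \<in> {1..i}" using assms by simp
  then show "pubs Vq pk (snt r j) \<subseteq> T i" "Var ` G j \<subseteq> T i" unfolding T_eq[OF assms(3)] by blast+
qed

lemma kernel_term_derivable:
  assumes "i \<le> N" "\<gamma> \<in> E i" "t \<in> aterms pk \<gamma>"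
  shows "dy R (S i) (tsubst \<sigma> t)"
proof -
  obtain j where j: "1 \<le> j" "j \<le> i" "\<gamma> \<in> at (snt r j)" using assms(2) by (auto simp: E_eq[OF assms(1)])
  have "j \<le> N" using j(2) assms(1) by simp
  note Ts = T_sent[OF j(1,2) assms(1)]
  have "Var ` G j \<subseteq> S i"
  proof
    fix s :: "('f, 'n, 'v) trm" assume "s \<in> Var ` G j"
    then obtain x where x: "s = Var x" "x \<in> G j" by blast
    then have "\<sigma> x = None" using dom_sigma_bv[OF j(1) \<open>j \<le> N\<close>] by blast
    then have "tsubst \<sigma> s = s" using x by simp
    moreover have "s \<in> T i" using Ts(2) x by blast
    ultimately show "s \<in> S i" by (metis imageI)
  qed
  moreover have "tsubst \<sigma> ` pubs Vq pk (snt r j) \<subseteq> S i" using Ts(1) by blast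
  moreover have "t \<in> aterms pk (snt r j)" using at_terms[OF j(3)] assms(3) by blast
  ultimately show ?thesis using sent_term_derivable[OF j(1) \<open>j \<le> N\<close>] by blast
qed

text \<open>Index \<open>k - 1\<close> is the knowledge from which the received instance was
  derived. By \<open>ded_terms\<close> its terms are derivable up to adjoined variables, and one of
  them contains the value of \<open>x\<close>.\<close>

lemma received_variable:
  assumes k: "1 \<le> k" "k \<le> N" and x: "x \<in> fv (rcv r k)"
  shows "\<exists>w. dy R (S (k - 1)) w \<and> tsubst \<sigma> (Var x) \<in> st w"
proof -
  define K where "K = fst (know r (k - 1) (intruder r))"
  have kN: "k - 1 \<le> N" using k by simp
  have K: "K = init r (intruder r) \<union> (\<Union>j\<in>{1..k - 1}. pubs Vq pk (snt r j))"
    unfolding K_def know_intruder[OF kN] by simp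
  have KT: "K \<subseteq> T (k - 1)" unfolding K T_eq[OF kN] by blast
  have ground: "vars s = {}" if s: "s \<in> tsubst \<sigma> ` K" for s
  proof -
    obtain s' where s': "s = tsubst \<sigma> s'" "s' \<in> K" using s by blast
    have "vars s' \<subseteq> fvs"
    proof (cases "s' \<in> init r (intruder r)")
      case True
      then show ?thesis using init_ground intruder_agent by blast
    next
      case False
      then obtain j where j: "1 \<le> j" "j \<le> k - 1" "s' \<in> pubs Vq pk (snt r j)" using s'(2) K by auto
      then have jN: "j \<le> N" using k by simp
      show ?thesis using vars_pubs_snt[OF j(1) jN j(3)] event_props(5)[OF j(1) jN] by blast
    qed
    then show ?thesis using s'(1) by (auto simp: vars_sigma)
  qed
  obtain g where g: "\<sigma> x = Some g" "vars g = {}"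
    using sigma_var x event_props(4)[OF k] by blast
  obtain t where t: "t \<in> aterms pk (asubst \<sigma> (rcv r k))" "g \<in> st t"
    using fv_st_asubst[of x "rcv r k" \<sigma> g pk] x g(1) by blast
  have d: "ded Vq pk R True (tsubst \<sigma> ` K) (asubst \<sigma> ` snt r ` {1..k - 1}) (asubst \<sigma> (rcv r k))"
    using know_step(4)[OF k] unfolding ded_a_def ksubst_def K_def know_intruder[OF kN] by simp
  have "dy R (with_vars (tsubst \<sigma> ` K)) t"
  proof (rule ded_terms[OF d _ _ t(1)])
    show "vground (tsubst \<sigma> ` K)" using ground by (simp add: vground_def)
    fix \<delta> u assume "\<delta> \<in> asubst \<sigma> ` snt r ` {1..k - 1}" "u \<in> aterms pk \<delta>"
    then obtain j where j: "1 \<le> j" "j \<le> k - 1" "u \<in> aterms pk (asubst \<sigma> (snt r j))" by auto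
    then have jN: "j \<le> N" using k by simp
    obtain u' where u': "u = tsubst \<sigma> u'" "u' \<in> aterms pk (snt r j)"
      using j(3) aterms_asubst[OF dom_sigma_bv[OF j(1) jN]] by auto
    have "j \<in> {1..k - 1}" using j by simp
    then have "tsubst \<sigma> ` pubs Vq pk (snt r j) \<subseteq> tsubst \<sigma> ` K" unfolding K by blast
    then show "dy R (with_vars (tsubst \<sigma> ` K)) u"
      unfolding u'(1) by (intro sent_term_derivable[OF j(1) jN u'(2)]) auto
  qed
  \<comment> \<open>The adjoined variables are removed by mapping every variable to the spare name,
    which the intruder always knows; the ground value \<open>g\<close> survives.\<close>
  then have "dy R (tsubst (\<lambda>_. Some (Nm (spare r))) ` with_vars (tsubst \<sigma> ` K))
      (tsubst (\<lambda>_. Some (Nm (spare r))) t)"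
    by (rule dy_tsubst)
  moreover have "tsubst (\<lambda>_. Some (Nm (spare r))) ` with_vars (tsubst \<sigma> ` K) \<subseteq> S (k - 1)"
  proof (rule image_subsetI)
    fix s assume "s \<in> with_vars (tsubst \<sigma> ` K)"
    then consider y where "s = Var y" | "s \<in> tsubst \<sigma> ` K" by blast
    then show "tsubst (\<lambda>_. Some (Nm (spare r))) s \<in> S (k - 1)"
    proof cases
      case 1
      have "tsubst \<sigma> (Nm (spare r)) \<in> S (k - 1)" using spare_T[OF kN] by blast
      then show ?thesis using 1 by simp
    next
      case 2
      then show ?thesis using KT ground[OF 2] by (auto simp: tsubst_ground)
    qed
  qed
  ultimately have "dy R (S (k - 1)) (tsubst (\<lambda>_. Some (Nm (spare r))) t)" by (rule dy_mono)
  moreover have "g \<in> st (tsubst (\<lambda>_. Some (Nm (spare r))) t)"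
    using st_tsubst_mono[OF t(2), of "\<lambda>_. Some (Nm (spare r))"] g(2) by (simp add: tsubst_ground)
  ultimately show ?thesis using g(1) by auto
qed

section \<open>Zapping\<close>

abbreviation "C \<equiv> CC pk r"
abbreviation "Z \<equiv> zap pk r"
abbreviation "\<sigma>s \<equiv> star pk r \<sigma>"
abbreviation "S' i \<equiv> tsubst \<sigma>s ` T i"

lemma C_st:
  assumes "s \<in> C" "t \<in> st s"
  shows "t \<in> C"
proof -
  define U where "U = (\<Union>i\<le>N. T i \<union> \<Union> (aterms pk ` E i)) \<union>
    (\<Union>i\<in>{1..N}. fst (UF r i) \<union> \<Union> (aterms pk ` snd (UF r i)))"
  have C: "C = \<Union> (st ` U)" by (simp add: CC_def ast_def U_def)
  then obtain w where "w \<in> U" "s \<in> st w" using assms(1) by blast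
  then show ?thesis unfolding C using st_trans[OF assms(2)] by blast
qed

lemma T_C: "i \<le> N \<Longrightarrow> T i \<subseteq> C"
proof
  fix t assume "i \<le> N" "t \<in> T i"
  then have "t \<in> \<Union> (st ` T i)" by (auto intro: bexI[of _ t])
  then show "t \<in> C" using \<open>i \<le> N\<close> unfolding CC_def by blast
qed

lemma E_C:
  assumes "i \<le> N" "\<gamma> \<in> E i" "t \<in> aterms pk \<gamma>"
  shows "t \<in> C"
proof -
  have "t \<in> ast pk \<gamma>" using assms(3) by (auto simp: ast_def intro: bexI[of _ t])
  then show ?thesis using assms(1,2) unfolding CC_def by blast
qed

lemma zappable_cong: "tsubst \<omega> s = tsubst \<omega> t \<Longrightarrow> zappable pk r s = zappable pk r t"
  by (simp add: zappable_def)

lemma not_zappable: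
  assumes "v \<in> C" "\<And>x. v \<noteq> Var x" "tsubst \<omega> t = tsubst \<omega> v"
  shows "\<not> zappable pk r t"
proof -
  have "v \<in> DD pk r" using assms(1,2) by (auto simp: DD_def)
  then show ?thesis unfolding zappable_def using assms(3) by metis
qed

lemma vars_zap: "vars (Z t) \<subseteq> vars t"
  by (induction t) auto

text \<open>Only absorption by \<open>\<omega>\<close> is asked of \<open>l\<close>, so that
  \<open>\<sigma>\<close> alone and its composite with \<open>mu r i\<close> are covered at
  once.\<close>

lemma zap_tsubst:
  assumes l: "\<And>t. tsubst \<omega> (tsubst l t) = tsubst \<omega> t" and v: "v \<in> C"
  shows "Z (tsubst l v) = tsubst (star pk r l) v"
  using v
proof (induction v)
  case (Var x)
  then show ?case by (cases "l x") (auto simp: star_def)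
next
  case (Nm a)
  then show ?case using not_zappable[of "Nm a" "Nm a"] by simp
next
  case (Fn f ts)
  then have "\<not> zappable pk r (tsubst l (Fn f ts))" using not_zappable[OF Fn.prems _ l] by simp
  moreover have "Z (tsubst l t) = tsubst (star pk r l) t" if "t \<in> set ts" for t
    using Fn.IH[OF that] C_st[OF Fn.prems, of t] that by (metis UN_I insertI2 st.simps(3) st_refl)
  ultimately show ?case by simp
qed

lemma zap_sigma: "v \<in> C \<Longrightarrow> Z (tsubst \<sigma> v) = tsubst \<sigma>s v"
  by (rule zap_tsubst[OF omega_sigma])

lemma zap_sigma_mu:
  assumes i: "1 \<le> i" "i \<le> N" and v: "v \<in> C"
  shows "Z (tsubst \<sigma> (tsubst (mu r i) v)) = tsubst \<sigma>s (tsubst (star pk r (mu r i)) v)"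
proof -
  have "tsubst \<omega> (tsubst (scomp \<sigma> (mu r i)) t) = tsubst \<omega> t" for t
    by (simp only: tsubst_scomp omega_sigma omega_mu[OF i])
  from zap_tsubst[OF this v]
  have "Z (tsubst \<sigma> (tsubst (mu r i) v)) = tsubst (star pk r (scomp \<sigma> (mu r i))) v"
    by (simp only: tsubst_scomp)
  also have "\<dots> = tsubst (scomp \<sigma>s (star pk r (mu r i))) v"
  proof (rule tsubst_cong)
    fix x
    show "tsubst (star pk r (scomp \<sigma> (mu r i))) (Var x) = tsubst (scomp \<sigma>s (star pk r (mu r i))) (Var x)"
    proof (cases "mu r i x")
      case None
      then show ?thesis by (cases "\<sigma> x") (auto simp: star_def scomp_def)
    next
      \<comment> \<open>The range of \<open>mu r i\<close> avoids the free variables of the run, so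
        neither \<open>\<sigma>\<close> nor \<open>\<sigma>s\<close> acts on it and zapping
        distributes over the composite.\<close>
      case (Some s)
      have "s \<in> ran (mu r i)" using Some by (auto simp: ran_def)
      moreover have "(\<Union>j\<in>{1..<i}. B j \<union> G j) \<inter> fvs = {}"
      proof -
        have "(B j \<union> G j) \<inter> fvs = {}" if "j \<in> {1..<i}" for j
          using event_props(6,7)[of j] that i by auto
        then show ?thesis by blast
      qed
      ultimately have s: "vars s \<inter> fvs = {}" using mu_vars(1)[OF i] by blast
      then have "tsubst \<sigma> s = s" using dom_sigma by (simp add: tsubst_disjoint)
      moreover have "dom \<sigma>s = fvs" unfolding dom_sigma[symmetric] by (auto simp: star_def)
      then have "tsubst \<sigma>s (Z s) = Z s" using s vars_zap[of s] by (intro tsubst_disjoint) blast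
      ultimately show ?thesis using Some by (auto simp: tsubst_scomp star_def scomp_def)
    qed
  qed
  finally show ?thesis by (simp only: tsubst_scomp)
qed

text \<open>
  A zappable term in the intruder's knowledge comes from a variable, hence from a term the intruder
  had sent before; at the first such occasion the intruder had to construct it.
\<close>

lemma zappable_origin:
  assumes "i \<le> N" "Fn f ts \<in> \<Union> (st ` S i)" "zappable pk r (Fn f ts)"
  shows "\<exists>k<i. dy R (S k) (Fn f ts) \<and> Fn f ts \<notin> \<Union> (st ` S k)"
  using assms(1,2)
proof (induction i rule: less_induct)
  case (less i)
  then obtain v where v: "v \<in> T i" "Fn f ts \<in> st (tsubst \<sigma> v)" by blast
  have "v \<in> C" using v(1) T_C[OF less.prems(1)] by blast
  have "\<not> (\<exists>t'\<in>st v. (\<forall>x. t' \<noteq> Var x) \<and> Fn f ts = tsubst \<sigma> t')"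
  proof
    assume "\<exists>t'\<in>st v. (\<forall>x. t' \<noteq> Var x) \<and> Fn f ts = tsubst \<sigma> t'"
    then obtain t' where t': "t' \<in> st v" "\<And>x. t' \<noteq> Var x" "Fn f ts = tsubst \<sigma> t'" by blast
    have "tsubst \<omega> (Fn f ts) = tsubst \<omega> t'" unfolding t'(3) by (rule omega_sigma)
    then show False using not_zappable[OF C_st[OF \<open>v \<in> C\<close> t'(1)] t'(2)] assms(3) by blast
  qed
  then obtain x where x: "x \<in> vars v" "Fn f ts \<in> st (tsubst \<sigma> (Var x))"
    using st_tsubst[OF v(2)] by blast
  have xf: "x \<in> fvs"
  proof (rule ccontr)
    assume "x \<notin> fvs"
    then have "\<sigma> x = None" using dom_sigma by blast
    then show False using x(2) by simp
  qed
  \<comment> \<open>Initial knowledge is ground and binders are never free in the run, so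
    \<open>v\<close> can only stem from the public terms of a sent assertion.\<close>
  obtain j where j: "1 \<le> j" "j \<le> i" "x \<in> fv (snt r j)"
  proof -
    have "v \<notin> init r (intruder r)" using init_ground intruder_agent x(1) by blast
    moreover have "v \<notin> Var ` (\<Union>j\<in>{1..i}. G j)"
    proof
      assume "v \<in> Var ` (\<Union>j\<in>{1..i}. G j)"
      then obtain l where "1 \<le> l" "l \<le> i" "x \<in> G l" using x(1) by auto
      then show False using event_props(7)[of l] xf less.prems(1) by auto
    qed
    ultimately obtain l where l: "1 \<le> l" "l \<le> i" "v \<in> pubs Vq pk (snt r l)"
      using v(1) unfolding T_eq[OF less.prems(1)] by auto
    then have "vars v \<subseteq> fv (snt r l)" using vars_pubs_snt less.prems(1) by simp
    then show ?thesis using that l x(1) by blast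
  qed
  have "j \<le> N" using j(2) less.prems(1) by simp
  obtain k where k: "1 \<le> k" "k \<le> j" "x \<in> fv (rcv r k)"
    using causal_run[OF j(1) \<open>j \<le> N\<close> j(3)] by blast
  have kN: "k \<le> N" "k - 1 < i" "k - 1 \<le> N" using k j less.prems(1) by auto
  obtain w where w: "dy R (S (k - 1)) w" "tsubst \<sigma> (Var x) \<in> st w"
    using received_variable[OF k(1) kN(1) k(3)] by blast
  have sub: "Fn f ts \<in> st w" using x(2) w(2) by (rule st_trans)
  show ?case
  proof (cases "Fn f ts \<in> \<Union> (st ` S (k - 1))")
    case True
    then obtain l where "l < k - 1" "dy R (S l) (Fn f ts) \<and> Fn f ts \<notin> \<Union> (st ` S l)"
      using less.IH[OF kN(2,3)] by blast
    then show ?thesis using kN(2) by (meson order.strict_trans)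
  next
    case False
    then have "dy R (S (k - 1)) (Fn f ts)" using dy_new_subterm[OF norm subt w(1) sub] by blast
    then show ?thesis using False kN(2) by blast
  qed
qed

lemma dy_zap: "i \<le> N \<Longrightarrow> dy R (S i) s \<Longrightarrow> dy R (S' i) (Z s)"
proof (induction i arbitrary: s rule: less_induct)
  case (less i)
  have spare_dy: "dy R (S' i) (Nm (spare r))"
  proof -
    have "tsubst \<sigma>s (Nm (spare r)) \<in> S' i" using spare_T[OF less.prems(1)] by blast
    then show ?thesis by (auto intro: dy_ax)
  qed
  show ?case using norm subt less.prems(2)
  proof (induction rule: dy_normal_induct)
    case (ax t)
    then obtain v where "v \<in> T i" "t = tsubst \<sigma> v" by blast
    then have "Z t = tsubst \<sigma>s v" using zap_sigma T_C[OF less.prems(1)] by blast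
    then show ?case using \<open>v \<in> T i\<close> by (auto intro: dy_ax)
  next
    case (con f ts)
    then show ?case using spare_dy by (auto intro!: dy_con)
  next
    case (des f n us j \<rho>)
    let ?major = "Fn f (map \<rho> [0..<n])"
    show ?case
    proof (cases "zappable pk r ?major")
      case True
      then obtain k where k: "k < i" "dy R (S k) ?major" "?major \<notin> \<Union> (st ` S k)"
        using zappable_origin[OF less.prems(1) des(3)] by blast
      have "dy R (S k) (\<rho> j)"
        by (rule dy_new_arguments[OF norm subt k(2,3)]) (use des(2) in simp)
      then have "dy R (S' k) (Z (\<rho> j))" using less.IH[OF k(1)] k(1) less.prems(1) by simp
      moreover have "S' k \<subseteq> S' i" using T_mono[of k i] k(1) less.prems(1) by (intro image_mono) simp
      ultimately show ?thesis by (rule dy_mono)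
    next
      case False
      then have zmajor: "Z ?major = Fn f (map (Z \<circ> \<rho>) [0..<n])" by simp
      have "dy R (S' i) ((Z \<circ> \<rho>) j)"
      proof (rule dy_des[OF des(1,2)])
        show "dy R (S' i) (Fn f (map (Z \<circ> \<rho>) [0..<n]))" using des(4) unfolding zmajor .
        fix u assume u: "u \<in> set us"
        \<comment> \<open>A composed side premise can only be the major premise, which keeps its
          head symbol in this case; so zapping commutes with instantiation.\<close>
        have "pinst (Z \<circ> \<rho>) u = Z (pinst \<rho> u)"
          using side_premise_cases[OF subt des(1,2) u]
        proof
          assume "\<exists>j. u = Meta j"
          then show ?thesis by auto
        next
          assume "u = PFn f (map Meta [0..<n])"
          then show ?thesis using zmajor by (simp add: comp_def)
        qed
        then show "dy R (S' i) (pinst (Z \<circ> \<rho>) u)" using des(5)[OF u] by simp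
      qed
      then show ?thesis by simp
    qed
  qed
qed

section \<open>Truth of the equalities in a run\<close>

lemma assn_true_asubst:
  assumes "\<And>t. tsubst w (tsubst l t) = tsubst w t"
  shows "assn_true w (asubst l \<gamma>) = assn_true w \<gamma>"
  using assms by (cases \<gamma>) auto

text \<open>An equality or list assertion inside a message is a leaf, and its instance is derived
  equationally from true assertions. Absorption then strips both substitutions from the
  instance.\<close>

lemma leaves_true:
  assumes wi: "witnesses Vq pk R \<sigma> K \<beta> X m" and K: "\<And>\<delta>. \<delta> \<in> snd K \<Longrightarrow> assn_true \<omega> \<delta>"
    and m: "\<And>t. tsubst \<omega> (tsubst m t) = tsubst \<omega> t" and \<gamma>: "\<gamma> \<in> at \<beta>"
  shows "assn_true \<omega> \<gamma>"
proof (cases "\<exists>k \<delta>. \<gamma> = Says k \<delta>")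
  case False
  then have "\<gamma> \<in> X" using covers_at[OF _ \<gamma>] wi by (auto simp: witnesses_def)
  then have d: "ded Vq pk R False (tsubst \<sigma> ` fst K) (asubst \<sigma> ` snd K) (asubst \<sigma> (asubst m \<gamma>))"
    using wi by (simp add: witnesses_def ded_eq_def ksubst_def)
  have "assn_true \<omega> (asubst \<sigma> (asubst m \<gamma>))"
    by (rule ded_eq_sound[OF d]) (use K in \<open>auto simp: assn_true_asubst[OF omega_sigma]\<close>)
  then show ?thesis by (simp only: assn_true_asubst[OF omega_sigma] assn_true_asubst[OF m])
qed auto

text \<open>Truth travels with the messages: what an agent receives is true because the earlier
  kernel of the intruder is, and what it sends is true because its own kernel, including the message
  just received, is.\<close>

lemma known_true: "i \<le> N \<Longrightarrow> a \<in> agents r \<Longrightarrow> \<delta> \<in> snd (ker (know r i a)) \<Longrightarrow> assn_true \<omega> \<delta>"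
proof (induction i arbitrary: a \<delta>)
  case 0
  then show ?case by (simp add: know_0 ker_def)
next
  case (Suc i)
  have i: "1 \<le> Suc i" "Suc i \<le> N" using Suc.prems(1) by auto
  have upd: "snd (ker (update Vq pk K \<gamma>)) = snd (ker K) \<union> at \<gamma>" for K \<gamma>
    by (auto simp: ker_def update_def)
  have rcv: "assn_true \<omega> \<gamma>" if "\<gamma> \<in> at (rcv r (Suc i))" for \<gamma>
  proof (rule leaves_true[OF witness_facts(1)[OF i] _ omega_mu[OF i] that])
    fix \<delta> assume "\<delta> \<in> snd (TE r (Suc i - 1))"
    then show "assn_true \<omega> \<delta>" using Suc.IH[OF _ intruder_agent] i by (simp add: TE_def)
  qed
  have act: "assn_true \<omega> \<delta>" if "\<delta> \<in> snd (ker (know r (Suc i) (actor r (Suc i))))" for \<delta>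
  proof -
    have "\<delta> \<in> snd (ker (know r i (actor r (Suc i)))) \<or> \<delta> \<in> at (rcv r (Suc i))"
      using that unfolding know_step(1)[OF i] upd by simp
    then show ?thesis using rcv Suc.IH[OF _ event_props(1)[OF i]] i(2) by (meson Suc_leD)
  qed
  have snt: "assn_true \<omega> \<gamma>" if "\<gamma> \<in> at (snt r (Suc i))" for \<gamma>
    by (rule leaves_true[OF witness_facts(2)[OF i] _ omega_theta[OF i] that])
      (use act in \<open>simp add: UF_def\<close>)
  consider "a = actor r (Suc i)" | "a = intruder r" | "a \<noteq> actor r (Suc i)" "a \<noteq> intruder r" by blast
  then show ?case
  proof cases
    case 1
    then show ?thesis using act Suc.prems by blast
  next
    case 2
    have "\<delta> \<in> snd (ker (know r i (intruder r))) \<or> \<delta> \<in> at (snt r (Suc i))"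
      using Suc.prems(3) unfolding 2 know_step(2)[OF i] upd by simp
    then show ?thesis using snt Suc.IH[OF _ intruder_agent] i(2) by (meson Suc_leD)
  next
    case 3
    then show ?thesis using Suc know_step(3)[OF i Suc.prems(2)] by simp
  qed
qed

lemma E_true: "i \<le> N \<Longrightarrow> \<delta> \<in> E i \<Longrightarrow> assn_true \<omega> \<delta>"
  using known_true[OF _ intruder_agent] by (simp add: TE_def)

lemma zap_transfer:
  assumes i: "i \<le> N"
  shows "zap_transfer R (S i) (S' i) (asubst \<sigma> ` E i) (asubst \<sigma>s ` E i) \<omega> (zappable pk r) Z
    (spare r) (\<Union> (st ` tsubst \<sigma> ` C))"
proof
  have "tsubst \<sigma>s (Nm (spare r)) \<in> S' i" using spare_T[OF i] by blast
  then show "dy R (S' i) (Nm (spare r))" by (auto intro: dy_ax)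
next
  fix f ts t assume "Fn f ts \<in> \<Union> (st ` tsubst \<sigma> ` C)" "t \<in> set ts"
  moreover from this have "t \<in> st (Fn f ts)" by (auto intro: bexI[of _ t])
  ultimately show "t \<in> \<Union> (st ` tsubst \<sigma> ` C)" using st_trans by blast
next
  fix f ts assume "Fn f ts \<in> \<Union> (st ` tsubst \<sigma> ` C)" and z: "zappable pk r (Fn f ts)"
  then obtain v where v: "v \<in> C" "Fn f ts \<in> st (tsubst \<sigma> v)" by blast
  from st_tsubst[OF v(2)] show "vars (Fn f ts) = {}"
  proof
    assume "\<exists>t'\<in>st v. (\<forall>x. t' \<noteq> Var x) \<and> Fn f ts = tsubst \<sigma> t'"
    then obtain t' where t': "t' \<in> st v" "\<And>x. t' \<noteq> Var x" "Fn f ts = tsubst \<sigma> t'" by blast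
    have "tsubst \<omega> (Fn f ts) = tsubst \<omega> t'" unfolding t'(3) by (rule omega_sigma)
    then show ?thesis using not_zappable[OF C_st[OF v(1) t'(1)] t'(2)] z by blast
  next
    assume "\<exists>x\<in>vars v. Fn f ts \<in> st (tsubst \<sigma> (Var x))"
    then obtain x where x: "Fn f ts \<in> st (tsubst \<sigma> (Var x))" by blast
    then obtain g where "\<sigma> x = Some g" by (cases "\<sigma> x") auto
    moreover from this have "vars g = {}" using ran_sigma by (auto simp: ran_def)
    ultimately show ?thesis using vars_st[OF x] by simp
  qed
next
  fix s t assume "Eq s t \<in> asubst \<sigma> ` E i"
  then obtain \<gamma> where \<gamma>: "\<gamma> \<in> E i" "Eq s t = asubst \<sigma> \<gamma>" by blast
  then obtain s' t' where st: "\<gamma> = Eq s' t'" "s = tsubst \<sigma> s'" "t = tsubst \<sigma> t'" by (cases \<gamma>) auto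
  have C: "s' \<in> C" "t' \<in> C" using E_C[OF i \<gamma>(1)] st(1) by auto
  have dy: "dy R (S i) s" "dy R (S i) t" using kernel_term_derivable[OF i \<gamma>(1)] st by auto
  have om: "tsubst \<omega> s = tsubst \<omega> t" using E_true[OF i \<gamma>(1)] st omega_sigma by simp
  have "asubst \<sigma>s \<gamma> = Eq (Z s) (Z t)" using zap_sigma C st by simp
  then have "Eq (Z s) (Z t) \<in> asubst \<sigma>s ` E i" using \<gamma>(1) by (metis imageI)
  moreover have "{s, t} \<subseteq> \<Union> (st ` tsubst \<sigma> ` C)" using C st st_refl by blast
  ultimately show "{s, t} \<subseteq> \<Union> (st ` tsubst \<sigma> ` C) \<and> dy R (S i) s \<and> dy R (S i) t \<and>
      tsubst \<omega> s = tsubst \<omega> t \<and> Eq (Z s) (Z t) \<in> asubst \<sigma>s ` E i"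
    using dy om by blast
next
  fix s ns assume "InList s ns \<in> asubst \<sigma> ` E i"
  then obtain \<gamma> where \<gamma>: "\<gamma> \<in> E i" "InList s ns = asubst \<sigma> \<gamma>" by blast
  then obtain s' where st: "\<gamma> = InList s' ns" "s = tsubst \<sigma> s'" by (cases \<gamma>) auto
  have C: "s' \<in> C" using E_C[OF i \<gamma>(1)] st(1) by auto
  have dy: "dy R (S i) s" using kernel_term_derivable[OF i \<gamma>(1)] st by auto
  have om: "tsubst \<omega> s \<in> Nm ` set ns" using E_true[OF i \<gamma>(1)] st omega_sigma by simp
  have "asubst \<sigma>s \<gamma> = InList (Z s) ns" using zap_sigma C st by simp
  then have "InList (Z s) ns \<in> asubst \<sigma>s ` E i" using \<gamma>(1) by (metis imageI)
  moreover have "s \<in> \<Union> (st ` tsubst \<sigma> ` C)" using C st st_refl by blast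
  \<comment> \<open>The names of a list count among the terms of the assertion, so they belong to
    \<open>C\<close> and are neither zappable nor unknown to the intruder.\<close>
  moreover have "Nm a \<in> \<Union> (st ` tsubst \<sigma> ` C) \<and> dy R (S i) (Nm a) \<and> \<not> zappable pk r (Nm a)"
    if "a \<in> set ns" for a
  proof -
    have a: "Nm a \<in> aterms pk \<gamma>" using that st(1) by simp
    have aC: "Nm a \<in> C" by (rule E_C[OF i \<gamma>(1) a])
    moreover have "dy R (S i) (tsubst \<sigma> (Nm a))" by (rule kernel_term_derivable[OF i \<gamma>(1) a])
    moreover have "Nm a \<in> st (tsubst \<sigma> (Nm a))" by simp
    ultimately show ?thesis
      using not_zappable[of "Nm a" "Nm a"] by (auto intro!: bexI[of _ "Nm a"])
  qed
  ultimately show "s \<in> \<Union> (st ` tsubst \<sigma> ` C) \<and> dy R (S i) s \<and> tsubst \<omega> s \<in> Nm ` set ns \<and>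
      InList (Z s) ns \<in> asubst \<sigma>s ` E i \<and>
      (\<forall>a\<in>set ns. Nm a \<in> \<Union> (st ` tsubst \<sigma> ` C) \<and> dy R (S i) (Nm a) \<and> \<not> zappable pk r (Nm a))"
    using dy om by blast
next
  fix s t :: "('f, 'n, 'v) trm" assume "tsubst \<omega> s = tsubst \<omega> t"
  then show "zappable pk r s = zappable pk r t" by (rule zappable_cong)
next
  fix s assume "dy R (S i) s"
  then show "dy R (S' i) (Z s)" by (rule dy_zap[OF i])
qed simp_all

end

theorem theorem5:
  fixes Vq :: "'v set" and pk :: 'f and R :: "'f drule set"
    and Pr :: "('f, 'n, 'v, 'p) role set" and r :: "('f, 'n, 'v, 'p) run"
    and t u :: "('f, 'n, 'v) trm" and i :: nat
  assumes "normalization TYPE(('f, 'n, 'v) trm) R"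
    and "subterm_property TYPE(('f, 'n, 'v) trm) R"
    and "is_protocol Vq Pr"
    and "is_run Vq pk R Pr r"
    and "run_witnesses Vq pk R r"
    and "spare_name pk r"
    and "t \<in> CC pk r" and "u \<in> CC pk r"
    and "1 \<le> i" and "i \<le> length (events r)"
  shows "(dy R (tsubst (sg r) ` fst (TE r (i - 1))) (tsubst (sg r) (tsubst (mu r i) t)) \<longrightarrow>
          dy R (tsubst (star pk r (sg r)) ` fst (TE r (i - 1)))
            (tsubst (star pk r (sg r)) (tsubst (star pk r (mu r i)) t))) \<and>
         (ded_eq Vq pk R (ksubst (sg r) (TE r (i - 1)))
            (asubst (sg r) (asubst (mu r i) (Eq t u))) \<longrightarrow>
          ded_eq Vq pk R (ksubst (star pk r (sg r)) (TE r (i - 1)))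
            (asubst (star pk r (sg r)) (asubst (star pk r (mu r i)) (Eq t u))))"
proof -
  interpret run_setting Vq pk R Pr r by unfold_locales (fact assms)+
  have i: "i - 1 \<le> N" using assms(10) by simp
  interpret zap_transfer Vq pk R "S (i - 1)" "S' (i - 1)" "asubst \<sigma> ` E (i - 1)" "asubst \<sigma>s ` E (i - 1)" \<omega>
    "zappable pk r" Z "spare r" "\<Union> (st ` tsubst \<sigma> ` C)"
    by (rule zap_transfer[OF i])
  have z: "tsubst \<sigma>s (tsubst (star pk r (mu r i)) v) = Z (tsubst \<sigma> (tsubst (mu r i) v))" if "v \<in> C" for v
    using zap_sigma_mu[OF assms(9,10) that] by simp
  show ?thesis
    unfolding ded_eq_def ksubst_def asubst.simps z[OF assms(7)] z[OF assms(8)] fst_conv snd_conv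
    using dy_zap[OF i] ded_zap by blast
qed

end
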